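(* Let $k\ge 3$, $m\ge 5$, and let $H\in\mathbb B^m$. Then (i) $\rho(B_2(m-4,1))<\rho(B_2(m-3,0))=\rho(B_3^1(m-2,0,0))$; (ii) if $H\notin\{B_2(m-4,1),B_2(m-3,0),B_3^1(m-2,0,0)\}$, then $\rho(H)<\rho(B_2(m-4,1))$.
   Context: A $k$-graph is a pair $H=(V,E)$ with $V$ a nonempty finite set and $E$ a set of $k$-element subsets of $V$ (edges); a multi-hypergraph allows repeated edges. With $V=\{1,\dots,n\}$, the adjacency tensor $\mathcal A(H)$ is the order-$k$ dimension-$n$ tensor with $\mathcal A_{i_1\cdots i_k}$ equal to the number of edges equal to $\{i_1,\dots,i_k\}$ divided by $(k-1)!$. $\lambda\in\mathbb C$ is an eigenvalue if there is a nonzero $x\in\mathbb C^n$ with $\sum_{i_2,\dots,i_k}\mathcal A_{ii_2\cdots i_k}x_{i_2}\cdots x_{i_k}=\lambda x_i^{k-1}$ for all $i$; $\rho(H)$ is the maximum modulus of the eigenvalues. A path is an alternating sequence $v_0e_1v_1\cdots e_sv_s$ of distinct vertices and edges with $v_{j-1},v_j\in e_j$; $H$ is connected if any two vertices lie on a common path. A connected $k$-graph with $n$ vertices and $m$ edges is bicyclic if $n=m(k-1)-1$. $\mathbb B^m$ is the set of connected bicyclic (simple) $k$-graphs with $m$ edges. Attaching a pendent edge at a vertex $x$ means adding a new edge consisting of $x$ and $k-1$ new vertices. For integers $a,b\ge 0$, $B_2(a,b)$ consists of three edges pairwise intersecting exactly in $\{u,v\}$ (their other vertices lying in no other edge), with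 $a$ pendent edges attached at $u$ and $b$ at $v$. For $a,b,c\ge0$, $B_3^1(a,b,c)$ consists of two edges $e_1,e_2$ with $e_1\cap e_2=\{u,v,w\}$ (their other vertices lying in no other edge), with $a,b,c$ pendent edges attached at $u,v,w$ respectively (for $k=3$ the two edges coincide and $B_3^1$ is a multi-hypergraph). *)

theory Defs
  imports Complex_Main "HOL-Library.Multiset"
begin

text \<open>A multi-hypergraph is a vertex set together with a multiset of edges. An ordinary \<open>k\<close>-graph
  is one in which every edge has multiplicity one.\<close>

type_synonym 'a hgraph = "'a set \<times> 'a set multiset"

abbreviation verts :: "'a hgraph \<Rightarrow> 'a set" where "verts \<equiv> fst"
abbreviation edges :: "'a hgraph \<Rightarrow> 'a set multiset" where "edges \<equiv> snd"

definition multi_kgraph :: "nat \<Rightarrow> 'a hgraph \<Rightarrow> bool" where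
  "multi_kgraph k H \<longleftrightarrow> finite (verts H) \<and> verts H \<noteq> {} \<and>
     (\<forall>e \<in># edges H. e \<subseteq> verts H \<and> card e = k)"

definition kgraph :: "nat \<Rightarrow> 'a hgraph \<Rightarrow> bool" where
  "kgraph k H \<longleftrightarrow> multi_kgraph k H \<and> (\<forall>e. count (edges H) e \<le> 1)"

definition hgraph_iso :: "'a hgraph \<Rightarrow> 'b hgraph \<Rightarrow> bool" where
  "hgraph_iso H G \<longleftrightarrow> (\<exists>f. bij_betw f (verts H) (verts G) \<and>
     image_mset (\<lambda>e. f ` e) (edges H) = edges G)"

text \<open>Tensor entries are indexed by lists of vertices of length \<open>k\<close>, the vertices themselves serving
  as indices in place of \<open>1, \<dots>, n\<close>.\<close>

definition adj_tensor :: "nat \<Rightarrow> 'a hgraph \<Rightarrow> 'a list \<Rightarrow> complex" where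
  "adj_tensor k H is = of_nat (count (edges H) (set is)) / fact (k - 1)"

definition hgraph_eigenvalue :: "nat \<Rightarrow> 'a hgraph \<Rightarrow> complex \<Rightarrow> bool" where
  "hgraph_eigenvalue k H \<mu> \<longleftrightarrow> (\<exists>x :: 'a \<Rightarrow> complex. (\<exists>i \<in> verts H. x i \<noteq> 0) \<and>
     (\<forall>i \<in> verts H.
        (\<Sum>js \<in> {js. set js \<subseteq> verts H \<and> length js = k - 1}.
           adj_tensor k H (i # js) * prod_list (map x js)) = \<mu> * x i ^ (k - 1)))"

definition rho :: "nat \<Rightarrow> 'a hgraph \<Rightarrow> real" where
  "rho k H = (GREATEST r. \<exists>\<mu>. hgraph_eigenvalue k H \<mu> \<and> r = cmod \<mu>)"

text \<open>The condition \<open>mset es \<subseteq># edges H\<close> says that the edges of the path are pairwise distinct members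
  of the edge multiset, parallel copies of an edge being distinct.\<close>

definition hpath :: "'a hgraph \<Rightarrow> 'a list \<Rightarrow> 'a set list \<Rightarrow> bool" where
  "hpath H vs es \<longleftrightarrow> length vs = Suc (length es) \<and>
     set vs \<subseteq> verts H \<and> distinct vs \<and> mset es \<subseteq># edges H \<and>
     (\<forall>j < length es. vs ! j \<in> es ! j \<and> vs ! Suc j \<in> es ! j)"

definition hconnected :: "'a hgraph \<Rightarrow> bool" where
  "hconnected H \<longleftrightarrow> (\<forall>u \<in> verts H. \<forall>v \<in> verts H.
     \<exists>vs es. hpath H vs es \<and> u \<in> set vs \<and> v \<in> set vs)"

text \<open>The equation \<open>n = m (k - 1) - 1\<close> is written additively to avoid truncated subtraction.\<close>

definition bicyclic :: "nat \<Rightarrow> 'a hgraph \<Rightarrow> bool" where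
  "bicyclic k H \<longleftrightarrow> hconnected H \<and> card (verts H) + 1 = size (edges H) * (k - 1)"

definition bicyclic_kgraphs :: "nat \<Rightarrow> nat \<Rightarrow> 'a hgraph set" where
  "bicyclic_kgraphs k m = {H. kgraph k H \<and> bicyclic k H \<and> size (edges H) = m}"

text \<open>The \<open>k - 1\<close> new vertices of a pendent edge are those following the largest present vertex.\<close>

definition attach_pendent :: "nat \<Rightarrow> nat \<Rightarrow> nat hgraph \<Rightarrow> nat hgraph" where
  "attach_pendent k x H =
     (let N = {Max (verts H) <.. Max (verts H) + (k - 1)}
      in (verts H \<union> N, add_mset (insert x N) (edges H)))"

text \<open>Here \<open>u = 0\<close> and \<open>v = 1\<close>.\<close>

definition B2 :: "nat \<Rightarrow> nat \<Rightarrow> nat \<Rightarrow> nat hgraph" where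
  "B2 k a b = (attach_pendent k 1 ^^ b) ((attach_pendent k 0 ^^ a)
     ({0..<3 * k - 4},
      {# {0, 1} \<union> {2..<k}, {0, 1} \<union> {k..<2 * k - 2}, {0, 1} \<union> {2 * k - 2..<3 * k - 4} #}))"

text \<open>Here \<open>u = 0\<close>, \<open>v = 1\<close> and \<open>w = 2\<close>; for \<open>k = 3\<close> the two edges coincide, giving an edge of
  multiplicity two.\<close>

definition B31 :: "nat \<Rightarrow> nat \<Rightarrow> nat \<Rightarrow> nat \<Rightarrow> nat hgraph" where
  "B31 k a b c = (attach_pendent k 2 ^^ c) ((attach_pendent k 1 ^^ b) ((attach_pendent k 0 ^^ a)
     ({0..<2 * k - 3}, {# {0, 1, 2} \<union> {3..<k}, {0, 1, 2} \<union> {k..<2 * k - 3} #})))"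

end

theory Submission
  imports Defs "HOL-Analysis.Analysis" "HOL-Combinatorics.Multiset_Permutations"
begin

text \<open>
  Let \<open>y\<close> be the vector of moduli of an eigenvector for an eigenvalue of largest modulus, and let \<open>u\<close>
  be a vertex where \<open>y\<close> is largest. Replacing, in every edge that avoids \<open>u\<close>, the vertex closest to \<open>u\<close>
  by \<open>u\<close> does not decrease any product of \<open>y\<close> over an edge, and it turns \<open>H\<close> into a star at \<open>u\<close> in
  which the degrees of the other vertices exceed 1 by 2 in total. By the weighted inequality between
  the arithmetic and the geometric mean, positive labels \<open>B v e\<close> with sum at most 1 at every vertex
  and product at least \<open>1 / t\<close> over every edge give \<open>\<rho>\<^sup>k \<le> t\<close>; the labels \<open>1 / deg v\<close> away from \<open>u\<close> show
  \<open>\<rho>\<^sup>k \<le> m + 5\<close>, unless the star is that of \<open>B\<^sub>2(m-3,0)\<close> or \<open>B\<^sub>3\<^sup>1(m-2,0,0)\<close>, for which \<open>\<rho>\<^sup>k = m + 6\<close>.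
  In these two cases, if any edge was moved, one of them is left in its place. The resulting bound is smaller than
  \<open>\<rho>(B\<^sub>2(m-4,1))\<^sup>k\<close>, the larger root of \<open>(t - m - 5)(t - 1) = 9\<close>, unless every moved edge is a pendent edge
  at the vertex of degree 3. Then \<open>H\<close> is some \<open>B\<^sub>2(a,b)\<close>, whose labels are explicit.
\<close>

section \<open>Eigenvalues and edge labellings\<close>

text \<open>This is the left-hand side of the eigenvalue equation at \<open>i\<close>, organised by
  edges instead of index lists. The type is general because the sum is applied both to complex
  eigenvectors and to their real vectors of moduli.\<close>

definition link_sum :: "'a hgraph \<Rightarrow> ('a \<Rightarrow> 'b::comm_semiring_1) \<Rightarrow> 'a \<Rightarrow> 'b" where
  "link_sum H x i = (\<Sum>e\<in>#edges H. if i \<in> e then prod x (e - {i}) else 0)"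

lemma sum_mset_eq_sum_count:
  fixes f :: "'a \<Rightarrow> 'b::comm_semiring_1"
  shows "(\<Sum>e\<in>#M. f e) = (\<Sum>e\<in>set_mset M. of_nat (count M e) * f e)"
proof (induction M)
  case (add e M)
  show ?case
  proof (cases "e \<in># M")
    case True
    then have "(\<Sum>a\<in>set_mset M. of_nat (count (add_mset e M) a) * f a)
        = (\<Sum>a\<in>set_mset M. of_nat (count M a) * f a + (if a = e then f a else 0))"
      by (intro sum.cong) (auto simp: algebra_simps)
    with True show ?thesis
      by (simp add: add.IH sum.distrib insert_absorb add.commute)
  next
    case False
    then have "(\<Sum>a\<in>set_mset M. of_nat (count (add_mset e M) a) * f a)
        = (\<Sum>a\<in>set_mset M. of_nat (count M a) * f a)"
      by (intro sum.cong) auto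
    moreover have "count M e = 0"
      using False by (simp add: not_in_iff)
    ultimately show ?thesis
      using False by (simp add: add.IH)
  qed
qed simp

lemma sum_sum_mset_swap:
  "(\<Sum>i\<in>A. \<Sum>e\<in>#M. f i e) = (\<Sum>e\<in>#M. \<Sum>i\<in>A. f i e :: 'b::comm_monoid_add)"
  by (induction M) (auto simp: sum.distrib)

lemma multi_kgraphD:
  assumes "multi_kgraph k H"
  shows "finite (verts H)" "verts H \<noteq> {}"
    "\<And>e. e \<in># edges H \<Longrightarrow> e \<subseteq> verts H" "\<And>e. e \<in># edges H \<Longrightarrow> card e = k"
    "\<And>e. e \<in># edges H \<Longrightarrow> finite e"
  using assms unfolding multi_kgraph_def by (blast intro: finite_subset)+

lemma card_lists_of_set:
  assumes "finite S"
  shows "card {js. set js = S \<and> length js = card S} = fact (card S)"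
proof -
  have "{js. set js = S \<and> length js = card S} = permutations_of_set S"
    unfolding permutations_of_set_def by (metis card_distinct distinct_card)
  then show ?thesis
    using assms by simp
qed

text \<open>A list contributes only if its entries together with \<open>i\<close> form an edge, and
  it is then an ordering of \<open>e - {i}\<close>. There are \<open>fact (k - 1)\<close> of these,
  which cancels the denominator of \<open>adj_tensor\<close> and leaves the multiplicity of the
  edge.\<close>

lemma tensor_sum_eq_link_sum:
  assumes H: "multi_kgraph k H" and k: "k \<ge> 1" and i: "i \<in> verts H"
  shows "(\<Sum>js \<in> {js. set js \<subseteq> verts H \<and> length js = k - 1}.
           adj_tensor k H (i # js) * prod_list (map x js)) = link_sum H x i"
proof -
  note HD = multi_kgraphD[OF H]
  define L where "L = {js. set js \<subseteq> verts H \<and> length js = k - 1}"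
  define E where "E = {e \<in> set_mset (edges H). i \<in> e}"
  define J where "J = (\<lambda>e. {js. set js = e - {i} \<and> length js = k - 1})"
  have finL: "finite L"
    unfolding L_def using finite_lists_length_eq[OF HD(1)] by simp
  have cardE: "card (e - {i}) = k - 1" "finite (e - {i})" if "e \<in> E" for e
    using that HD(4,5)[of e] by (auto simp: E_def)
  \<comment> \<open>A list of length \<open>k\<close> whose entries form a set of size
    \<open>k\<close> has no repetitions, so \<open>i\<close> does not recur in
    \<open>js\<close>.\<close>
  have cond: "i \<notin> set js \<and> distinct js"
    if "set (i # js) \<in># edges H" "length js = k - 1" for js
  proof -
    have "card (set (i # js)) = length (i # js)"
      using HD(4)[OF that(1)] that(2) k by simp
    then show ?thesis
      using card_distinct[of "i # js"] by auto
  qed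
  have J_sub: "(\<Union>e\<in>E. J e) \<subseteq> L"
    using HD(3) by (auto simp: E_def J_def L_def)
  have zero: "adj_tensor k H (i # js) * prod_list (map x js) = 0" if "js \<in> L - (\<Union>e\<in>E. J e)" for js
  proof -
    have "set (i # js) \<notin># edges H"
    proof
      assume *: "set (i # js) \<in># edges H"
      then have "js \<in> J (set (i # js))"
        using that cond[OF *] by (auto simp: L_def J_def)
      moreover have "set (i # js) \<in> E"
        using * by (simp add: E_def)
      ultimately show False
        using that by blast
    qed
    then have "count (edges H) (set (i # js)) = 0"
      by (simp only: not_in_iff)
    then show ?thesis
      unfolding adj_tensor_def by simp
  qed
  have finE: "finite E"
    by (simp add: E_def)
  have finJ: "finite (J e)" if "e \<in> E" for e
    using finL J_sub that by (meson UN_subset_iff finite_subset)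
  have "(\<Sum>js\<in>L. adj_tensor k H (i # js) * prod_list (map x js))
      = (\<Sum>js\<in>(\<Union>e\<in>E. J e). adj_tensor k H (i # js) * prod_list (map x js))"
    using zero by (intro sum.mono_neutral_right finL J_sub) auto
  also have "\<dots> = (\<Sum>e\<in>E. \<Sum>js\<in>J e. adj_tensor k H (i # js) * prod_list (map x js))"
    using finE finJ by (intro sum.UNION_disjoint) (auto simp: J_def E_def)
  also have "\<dots> = (\<Sum>e\<in>E. of_nat (count (edges H) e) * prod x (e - {i}))"
  proof (intro sum.cong refl)
    fix e assume e: "e \<in> E"
    have "adj_tensor k H (i # js) * prod_list (map x js)
        = of_nat (count (edges H) e) / fact (k - 1) * prod x (e - {i})" if "js \<in> J e" for js
    proof -
      have se: "set (i # js) = e" and len: "length js = k - 1"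
        using e that by (auto simp: J_def E_def)
      have "distinct js" and sj: "set js = e - {i}"
        using cond[of js] se len e that by (auto simp: E_def J_def)
      then have "prod_list (map x js) = prod x (e - {i})"
        by (simp add: prod.distinct_set_conv_list flip: sj)
      then show ?thesis
        using se by (simp add: adj_tensor_def)
    qed
    then have "(\<Sum>js\<in>J e. adj_tensor k H (i # js) * prod_list (map x js))
        = of_nat (card (J e)) * (of_nat (count (edges H) e) / fact (k - 1) * prod x (e - {i}))"
      by simp
    also have "card (J e) = fact (k - 1)"
      using card_lists_of_set[OF cardE(2)[OF e]] cardE(1)[OF e] by (simp add: J_def)
    finally show "(\<Sum>js\<in>J e. adj_tensor k H (i # js) * prod_list (map x js))
        = of_nat (count (edges H) e) * prod x (e - {i})"
      by simp
  qed
  also have "\<dots> = link_sum H x i"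
    unfolding link_sum_def sum_mset_eq_sum_count E_def
    by (simp add: sum.inter_filter if_distrib[of "(*) _"] cong: if_cong)
  finally show ?thesis
    by (simp add: L_def)
qed

lemma hgraph_eigenvalue_iff:
  assumes "multi_kgraph k H" "k \<ge> 1"
  shows "hgraph_eigenvalue k H \<mu> \<longleftrightarrow>
    (\<exists>x. (\<exists>i\<in>verts H. x i \<noteq> 0) \<and> (\<forall>i\<in>verts H. link_sum H x i = \<mu> * x i ^ (k - 1)))"
  unfolding hgraph_eigenvalue_def using tensor_sum_eq_link_sum[OF assms] by auto

text \<open>Each edge is counted once from each of its \<open>k\<close> vertices, every time with
  its full product.\<close>

lemma sum_link_sum:
  fixes y :: "'a \<Rightarrow> 'b::comm_semiring_1"
  assumes H: "multi_kgraph k H"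
  shows "(\<Sum>i\<in>verts H. y i * link_sum H y i) = of_nat k * (\<Sum>e\<in>#edges H. prod y e)"
proof -
  note HD = multi_kgraphD[OF H]
  have "y i * link_sum H y i = (\<Sum>e\<in>#edges H. if i \<in> e then prod y e else 0)" for i
    unfolding link_sum_def sum_mset_distrib_left
    by (intro arg_cong[where f = sum_mset] image_mset_cong)
       (auto simp: prod.remove[OF HD(5), of _ i])
  then have "(\<Sum>i\<in>verts H. y i * link_sum H y i)
      = (\<Sum>e\<in>#edges H. \<Sum>i\<in>verts H. if i \<in> e then prod y e else 0)"
    by (simp add: sum_sum_mset_swap)
  also have "\<dots> = (\<Sum>e\<in>#edges H. of_nat k * prod y e)"
  proof (intro arg_cong[where f = sum_mset] image_mset_cong)
    fix e assume e: "e \<in># edges H"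
    have "(\<Sum>i\<in>verts H. if i \<in> e then prod y e else 0) = (\<Sum>i\<in>verts H \<inter> e. prod y e)"
      by (rule sum.inter_restrict[OF HD(1), symmetric])
    also have "verts H \<inter> e = e"
      using HD(3)[OF e] by auto
    finally show "(\<Sum>i\<in>verts H. if i \<in> e then prod y e else 0) = of_nat k * prod y e"
      using HD(4)[OF e] by simp
  qed
  finally show ?thesis
    by (simp add: sum_mset_distrib_left)
qed

lemma norm_sum_mset_le: "norm (\<Sum>e\<in>#M. f e :: 'b::real_normed_vector) \<le> (\<Sum>e\<in>#M. norm (f e))"
  by (induction M) (auto intro: order_trans[OF norm_triangle_ineq])

text \<open>The triangle inequality turns the eigenvalue equation at \<open>i\<close> into an
  inequality between moduli; multiplied by \<open>y i\<close> and summed over \<open>i\<close>, it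
  involves only products over whole edges. The vector \<open>y\<close> itself need not be an
  eigenvector.\<close>

lemma eigenvalue_moduli:
  assumes H: "multi_kgraph k H" "k \<ge> 1" and ev: "hgraph_eigenvalue k H \<mu>"
  obtains y :: "'a \<Rightarrow> real" where "\<And>i. y i \<ge> 0" "\<exists>i\<in>verts H. y i > 0"
    "cmod \<mu> * (\<Sum>i\<in>verts H. y i ^ k) \<le> real k * (\<Sum>e\<in>#edges H. prod y e)"
proof -
  obtain x where x: "\<exists>i\<in>verts H. x i \<noteq> 0"
    and eq: "\<And>i. i \<in> verts H \<Longrightarrow> link_sum H x i = \<mu> * x i ^ (k - 1)"
    using ev hgraph_eigenvalue_iff[OF H] by auto
  define y where "y i = cmod (x i)" for i
  have le: "cmod \<mu> * y i ^ (k - 1) \<le> link_sum H y i" if "i \<in> verts H" for i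
  proof -
    have "cmod \<mu> * y i ^ (k - 1) = cmod (link_sum H x i)"
      by (simp add: eq[OF that] norm_mult norm_power y_def)
    also have "\<dots> \<le> (\<Sum>e\<in>#edges H. cmod (if i \<in> e then prod x (e - {i}) else 0))"
      unfolding link_sum_def by (rule norm_sum_mset_le)
    also have "\<dots> = link_sum H y i"
      unfolding link_sum_def y_def
      by (intro arg_cong[where f = sum_mset] image_mset_cong) (auto simp: prod_norm)
    finally show ?thesis .
  qed
  have "cmod \<mu> * (\<Sum>i\<in>verts H. y i ^ k) = (\<Sum>i\<in>verts H. y i * (cmod \<mu> * y i ^ (k - 1)))"
    using H(2) by (simp add: sum_distrib_left power_minus_mult[of k, symmetric] mult_ac)
  also have "\<dots> \<le> (\<Sum>i\<in>verts H. y i * link_sum H y i)"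
    by (intro sum_mono mult_left_mono le) (auto simp: y_def)
  finally have "cmod \<mu> * (\<Sum>i\<in>verts H. y i ^ k) \<le> real k * (\<Sum>e\<in>#edges H. prod y e)"
    by (simp add: sum_link_sum[OF H(1)])
  with x show ?thesis
    by (intro that[of y]) (auto simp: y_def)
qed

section \<open>Bounding eigenvalues by labels on pairs of a vertex and an edge\<close>

text \<open>The inequality of the means is applied to the numbers \<open>B v * y v ^ k\<close>,
  whose product is at least \<open>prod y e ^ k / t\<close> by the condition on the labels.\<close>

lemma weighted_amgm:
  fixes y B :: "'a \<Rightarrow> real"
  assumes e: "card e = k" "k \<ge> 1" and y: "\<And>v. v \<in> e \<Longrightarrow> y v \<ge> 0"
    and B: "\<And>v. v \<in> e \<Longrightarrow> B v > 0" and t: "t * prod B e \<ge> 1" "t > 0"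
  shows "real k * prod y e \<le> root k t * (\<Sum>v\<in>e. B v * y v ^ k)"
proof -
  have fin: "finite e" "e \<noteq> {}"
    using e card_gt_0_iff[of e] by auto
  have nn: "B v * y v ^ k \<ge> 0" if "v \<in> e" for v
    using y[OF that] B[OF that] by simp
  have k0: "k > 0" using e by simp
  have pn: "(\<Prod>v\<in>e. B v * y v ^ k) \<ge> 0"
    by (intro prod_nonneg nn)
  have py: "prod y e \<ge> 0" using y by (auto intro: prod_nonneg)
  have "root k (\<Prod>v\<in>e. B v * y v ^ k) = (\<Prod>v\<in>e. B v * y v ^ k) powr (1 / card e)"
    using pn k0 e(1) by (cases "(\<Prod>v\<in>e. B v * y v ^ k) = 0") (auto simp: root_powr_inverse)
  also have "\<dots> \<le> (\<Sum>v\<in>e. B v * y v ^ k / card e)"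
    using arith_geom_mean[OF fin nn] by simp
  finally have am: "real k * root k (\<Prod>v\<in>e. B v * y v ^ k) \<le> (\<Sum>v\<in>e. B v * y v ^ k)"
    using k0 e(1) by (simp add: field_simps flip: sum_divide_distrib)
  have "prod y e = root k (prod y e ^ k)"
    using py k0 by (simp add: real_root_power_cancel)
  also have "\<dots> \<le> root k (t * prod B e * prod y e ^ k)"
    using k0 t py mult_right_mono[OF t(1), of "prod y e ^ k"] by simp
  also have "t * prod B e * prod y e ^ k = t * (\<Prod>v\<in>e. B v * y v ^ k)"
    by (simp add: prod.distrib prod_power_distrib)
  also have "root k \<dots> = root k t * root k (\<Prod>v\<in>e. B v * y v ^ k)"
    by (simp add: real_root_mult)
  finally have "real k * prod y e \<le> root k t * (real k * root k (\<Prod>v\<in>e. B v * y v ^ k))"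
    using k0 by simp
  also have "\<dots> \<le> root k t * (\<Sum>v\<in>e. B v * y v ^ k)"
    using am t k0 by (intro mult_left_mono) auto
  finally show ?thesis .
qed

text \<open>The bounds for the single edges are added and regrouped by vertices. Once the labels at
  every vertex sum to at most 1, the right-hand side is at most \<open>root k t\<close> times the
  sum of the \<open>k\<close>-th powers. The map \<open>\<phi>\<close> lets each edge be replaced by
  another \<open>k\<close>-set.\<close>

lemma labelling_sum_bound:
  fixes y :: "'a \<Rightarrow> real" and \<phi> :: "'e \<Rightarrow> 'a set"
  assumes V: "finite V" and k: "k \<ge> 1" and t: "t > 0"
    and y: "\<And>v. v \<in> V \<Longrightarrow> y v \<ge> 0"
    and \<phi>: "\<And>e. e \<in># M \<Longrightarrow> \<phi> e \<subseteq> V \<and> card (\<phi> e) = k"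
    and B: "\<And>e v. e \<in># M \<Longrightarrow> v \<in> \<phi> e \<Longrightarrow> B v e > 0"
    and Bt: "\<And>e. e \<in># M \<Longrightarrow> t * (\<Prod>v\<in>\<phi> e. B v e) \<ge> 1"
  shows "real k * (\<Sum>e\<in>#M. prod y (\<phi> e))
    \<le> root k t * (\<Sum>v\<in>V. y v ^ k * (\<Sum>e\<in>#M. if v \<in> \<phi> e then B v e else 0))"
proof -
  have "real k * (\<Sum>e\<in>#M. prod y (\<phi> e)) = (\<Sum>e\<in>#M. real k * prod y (\<phi> e))"
    by (simp add: sum_mset_distrib_left)
  also have "\<dots> \<le> (\<Sum>e\<in>#M. root k t * (\<Sum>v\<in>\<phi> e. B v e * y v ^ k))"
  proof (rule sum_mset_mono)
    fix e assume e: "e \<in># M"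
    show "real k * prod y (\<phi> e) \<le> root k t * (\<Sum>v\<in>\<phi> e. B v e * y v ^ k)"
      using \<phi>[OF e] k y B[OF e] Bt[OF e] t by (intro weighted_amgm) auto
  qed
  also have "\<dots> = (\<Sum>e\<in>#M. \<Sum>v\<in>V. root k t * (if v \<in> \<phi> e then B v e * y v ^ k else 0))"
  proof (intro arg_cong[where f = sum_mset] image_mset_cong)
    fix e assume "e \<in># M"
    then have "V \<inter> \<phi> e = \<phi> e"
      using \<phi> by auto
    then have "(\<Sum>v\<in>\<phi> e. B v e * y v ^ k) = (\<Sum>v\<in>V. if v \<in> \<phi> e then B v e * y v ^ k else 0)"
      using sum.inter_restrict[OF V, of "\<lambda>v. B v e * y v ^ k" "\<phi> e"] by simp
    then show "root k t * (\<Sum>v\<in>\<phi> e. B v e * y v ^ k)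
        = (\<Sum>v\<in>V. root k t * (if v \<in> \<phi> e then B v e * y v ^ k else 0))"
      by (simp add: sum_distrib_left)
  qed
  also have "\<dots> = (\<Sum>v\<in>V. \<Sum>e\<in>#M. root k t * (if v \<in> \<phi> e then B v e * y v ^ k else 0))"
    by (rule sum_sum_mset_swap[symmetric])
  also have "\<dots> = root k t * (\<Sum>v\<in>V. y v ^ k * (\<Sum>e\<in>#M. if v \<in> \<phi> e then B v e else 0))"
    unfolding sum_distrib_left sum_mset_distrib_left
    by (intro sum.cong refl arg_cong[where f = sum_mset] image_mset_cong) (auto simp: mult_ac)
  finally show ?thesis .
qed

text \<open>Up to a constant factor, \<open>f e\<close> is the product over \<open>e\<close> of the entries of a positive eigenvector, whose
  \<open>k\<close>-th powers are then the sums \<open>S\<close>.\<close>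

lemma rho_eq_root:
  fixes f :: "'a set \<Rightarrow> real"
  assumes H: "multi_kgraph k H" and k: "k \<ge> 1" and t: "t > 0"
    and f: "\<And>e. e \<in># edges H \<Longrightarrow> f e > 0"
    and S: "\<And>v. v \<in> verts H \<Longrightarrow> S v = (\<Sum>e\<in>#edges H. if v \<in> e then f e else 0)"
    and pos: "\<And>v. v \<in> verts H \<Longrightarrow> S v > 0"
    and eq: "\<And>e. e \<in># edges H \<Longrightarrow> t * f e ^ k = prod S e"
  shows "rho k H = root k t"
  unfolding rho_def
proof (rule Greatest_equality)
  note HD = multi_kgraphD[OF H]
  define x where "x v = root k (S v)" for v
  have k0: "k > 0" using k by simp
  have xk: "x v ^ k = S v" and xpos: "x v > 0" if "v \<in> verts H" for v
    using k0 pos[OF that] by (auto simp: x_def)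
  have px: "prod x e = root k t * f e" if "e \<in># edges H" for e
  proof -
    have v: "v \<in> verts H" if "v \<in> e" for v
      using that HD(3)[OF \<open>e \<in># edges H\<close>] by auto
    have "prod x e ^ k = prod S e"
      unfolding prod_power_distrib by (intro prod.cong refl xk v)
    also have "\<dots> = (root k t * f e) ^ k"
      using t k0 by (simp add: eq[OF that, symmetric] power_mult_distrib)
    finally have "prod x e ^ k = (root k t * f e) ^ k" .
    moreover have "prod x e \<ge> 0"
      using xpos v by (intro prod_nonneg) (simp add: less_imp_le)
    moreover have "root k t * f e \<ge> 0"
      using f[OF that] t k0 by simp
    ultimately show ?thesis
      using k0 power_eq_imp_eq_base by blast
  qed
  have eigen: "link_sum H x i = root k t * x i ^ (k - 1)" if i: "i \<in> verts H" for i
  proof -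
    have "x i * link_sum H x i = (\<Sum>e\<in>#edges H. if i \<in> e then prod x e else 0)"
      unfolding link_sum_def sum_mset_distrib_left
      by (intro arg_cong[where f = sum_mset] image_mset_cong)
         (auto simp: prod.remove[OF HD(5), of _ i])
    also have "\<dots> = (\<Sum>e\<in>#edges H. root k t * (if i \<in> e then f e else 0))"
      by (intro arg_cong[where f = sum_mset] image_mset_cong) (auto simp: px)
    also have "\<dots> = root k t * x i ^ k"
      by (simp add: sum_mset_distrib_left xk i S)
    also have "x i ^ k = x i * x i ^ (k - 1)"
      using k0 power_minus_mult[of k "x i"] by (simp add: mult.commute)
    finally show ?thesis
      using xpos[OF i] by simp
  qed
  have "link_sum H (\<lambda>v. of_real (x v)) i = (of_real (link_sum H x i) :: complex)" for i
  proof -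
    have "(\<Sum>e\<in>#M. if i \<in> e then \<Prod>v\<in>e - {i}. complex_of_real (x v) else 0)
        = of_real (\<Sum>e\<in>#M. if i \<in> e then prod x (e - {i}) else 0)" for M
      by (induction M) auto
    then show ?thesis
      by (simp add: link_sum_def)
  qed
  then have "\<forall>i\<in>verts H. link_sum H (\<lambda>v. of_real (x v)) i
      = complex_of_real (root k t) * of_real (x i) ^ (k - 1)"
    by (simp add: eigen)
  moreover have "\<exists>i\<in>verts H. complex_of_real (x i) \<noteq> 0"
    using HD(2) xpos by (metis all_not_in_conv less_irrefl of_real_eq_0_iff)
  ultimately have "hgraph_eigenvalue k H (of_real (root k t))"
    unfolding hgraph_eigenvalue_iff[OF H k]
    by (intro exI[of _ "\<lambda>v. complex_of_real (x v)"] conjI)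
  moreover have "root k t = cmod (of_real (root k t))"
    using t k0 by simp
  ultimately show "\<exists>\<mu>. hgraph_eigenvalue k H \<mu> \<and> root k t = cmod \<mu>"
    by blast
next
  note HD = multi_kgraphD[OF H]
  fix r assume "\<exists>\<mu>. hgraph_eigenvalue k H \<mu> \<and> r = cmod \<mu>"
  then obtain \<mu> where \<mu>: "hgraph_eigenvalue k H \<mu>" "r = cmod \<mu>" by auto
  obtain y where y: "\<And>i. y i \<ge> 0" "\<exists>i\<in>verts H. y i > 0"
    "cmod \<mu> * (\<Sum>i\<in>verts H. y i ^ k) \<le> real k * (\<Sum>e\<in>#edges H. prod y e)"
    using eigenvalue_moduli[OF H k \<mu>(1)] by metis
  \<comment> \<open>The labels \<open>f e / S v\<close> have product exactly \<open>1 / t\<close>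
    over every edge and sum exactly 1 at every vertex, so the labelling bound is sharp here.\<close>
  have "t * (\<Prod>v\<in>e. f e / S v) = 1" if e: "e \<in># edges H" for e
  proof -
    have "prod S e \<noteq> 0"
      using pos HD(3)[OF e] HD(5)[OF e] by (auto simp: prod_zero_iff less_le)
    then show ?thesis
      using HD(4)[OF e] eq[OF e] by (simp add: prod_dividef)
  qed
  moreover have "f e / S v > 0" if "e \<in># edges H" "v \<in> e" for e v
    using f pos HD(3) that by (meson divide_pos_pos subsetD)
  ultimately have "real k * (\<Sum>e\<in>#edges H. prod y e)
      \<le> root k t * (\<Sum>v\<in>verts H. y v ^ k * (\<Sum>e\<in>#edges H. if v \<in> e then f e / S v else 0))"
    using HD y(1) k t by (intro labelling_sum_bound) auto
  also have "(\<Sum>v\<in>verts H. y v ^ k * (\<Sum>e\<in>#edges H. if v \<in> e then f e / S v else 0))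
      = (\<Sum>v\<in>verts H. y v ^ k)"
  proof (intro sum.cong refl)
    fix v assume v: "v \<in> verts H"
    have "(\<Sum>e\<in>#edges H. if v \<in> e then f e / S v else 0)
        = (\<Sum>e\<in>#edges H. (1 / S v) * (if v \<in> e then f e else 0))"
      by (intro arg_cong[where f = sum_mset] image_mset_cong) auto
    also have "\<dots> = 1 / S v * S v"
      unfolding S[OF v] by (simp only: sum_mset_distrib_left)
    also have "\<dots> = 1"
      using pos[OF v] by simp
    finally show "y v ^ k * (\<Sum>e\<in>#edges H. if v \<in> e then f e / S v else 0) = y v ^ k"
      by simp
  qed
  finally have "cmod \<mu> * (\<Sum>i\<in>verts H. y i ^ k) \<le> root k t * (\<Sum>i\<in>verts H. y i ^ k)"
    using y(3) by linarith
  moreover have "(\<Sum>i\<in>verts H. y i ^ k) > 0"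
    using y(1,2) HD(1) by (auto intro!: sum_pos2)
  ultimately show "r \<le> root k t"
    using \<mu>(2) by simp
qed

section \<open>Existence of an eigenvalue of largest modulus\<close>

lemma ex_maximal_value:
  fixes f :: "'a \<Rightarrow> 'b::linorder"
  assumes "finite A" "A \<noteq> {}"
  obtains u where "u \<in> A" "\<And>v. v \<in> A \<Longrightarrow> f v \<le> f u"
proof -
  have "Max (f ` A) \<in> f ` A"
    using assms by (intro Max_in) auto
  then obtain u where "u \<in> A" "f u = Max (f ` A)"
    by auto
  with assms show ?thesis
    by (intro that[of u]) auto
qed

text \<open>Pinning the coordinates outside \<open>A\<close> to 0 makes the set a product of compact
  sets over the whole type, so Tychonoff's theorem applies even if the type is infinite.\<close>

lemma compact_Pi_cball:
  fixes A :: "'a set"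
  shows "compact {x :: 'a \<Rightarrow> complex. (\<forall>i\<in>A. norm (x i) \<le> 1) \<and> (\<forall>i\<in>-A. x i = 0)}"
proof -
  have "{x :: 'a \<Rightarrow> complex. (\<forall>i\<in>A. norm (x i) \<le> 1) \<and> (\<forall>i\<in>-A. x i = 0)}
      = PiE UNIV (\<lambda>i. if i \<in> A then cball 0 1 else {0})"
    by (auto simp: PiE_def Pi_def)
  moreover have "compactin (product_topology (\<lambda>i. euclidean) UNIV)
      (PiE UNIV (\<lambda>i :: 'a. if i \<in> A then cball 0 1 else {0 :: complex}))"
    unfolding compactin_PiE by auto
  ultimately show ?thesis
    by (simp add: euclidean_product_topology)
qed

lemma link_sum_eq_sum_count:
  "link_sum H x i = (\<Sum>e\<in>set_mset (edges H). of_nat (count (edges H) e) *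
     (if i \<in> e then prod x (e - {i}) else 0))"
  unfolding link_sum_def by (rule sum_mset_eq_sum_count)

lemma continuous_on_link_sum:
  "continuous_on S (\<lambda>x :: 'a \<Rightarrow> complex. link_sum H x i)"
proof -
  have "continuous_on S (\<lambda>x :: 'a \<Rightarrow> complex. if i \<in> e then prod x (e - {i}) else 0)" for e
    by (cases "i \<in> e") (auto intro!: continuous_intros continuous_on_subset[OF continuous_on_product_coordinates])
  then show ?thesis
    unfolding link_sum_eq_sum_count by (intro continuous_intros)
qed

lemma link_sum_scale:
  assumes H: "multi_kgraph k H"
  shows "link_sum H (\<lambda>v. c * x v) i = c ^ (k - 1) * link_sum H x i"
  unfolding link_sum_def sum_mset_distrib_left
proof (intro arg_cong[where f = sum_mset] image_mset_cong)
  fix e assume "e \<in># edges H"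
  then have "card (e - {i}) = k - 1" if "i \<in> e"
    using that multi_kgraphD[OF H] by auto
  then show "(if i \<in> e then \<Prod>v\<in>e - {i}. c * x v else 0)
      = c ^ (k - 1) * (if i \<in> e then prod x (e - {i}) else 0)"
    by (simp add: prod.distrib)
qed

lemma link_sum_cong:
  assumes "multi_kgraph k H" "\<And>v. v \<in> verts H \<Longrightarrow> x v = y v"
  shows "link_sum H x i = link_sum H y i"
  unfolding link_sum_def
proof (intro arg_cong[where f = sum_mset] image_mset_cong)
  fix e assume "e \<in># edges H"
  then have "prod x (e - {i}) = prod y (e - {i})"
    using multi_kgraphD(3)[OF assms(1)] assms(2) by (intro prod.cong) auto
  then show "(if i \<in> e then prod x (e - {i}) else 0) = (if i \<in> e then prod y (e - {i}) else 0)"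
    by simp
qed

text \<open>Scaling an eigenvector so that an entry of largest modulus becomes 1, the eigenvalue is
  the link sum at that entry. Hence the eigenvalues form a compact set.\<close>

lemma compact_eigenvalues:
  assumes H: "multi_kgraph k H" and k: "k \<ge> 1"
  shows "compact {\<mu>. hgraph_eigenvalue k H \<mu>}"
proof -
  note HD = multi_kgraphD[OF H]
  \<comment> \<open>The eigenvalue is eliminated in favour of \<open>link_sum H x i\<close>, which
    makes every condition closed in \<open>x\<close> alone.\<close>
  define K where "K i = {x :: 'a \<Rightarrow> complex. (\<forall>j\<in>verts H. norm (x j) \<le> 1) \<and> (\<forall>j\<in>-verts H. x j = 0)}
    \<inter> {x. x i = 1} \<inter> (\<Inter>j\<in>verts H. {x. link_sum H x j = link_sum H x i * x j ^ (k - 1)})" for i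
  have "compact (K i)" for i
    unfolding K_def
    by (intro compact_Int_closed compact_Pi_cball closed_INT ballI closed_Collect_eq
        continuous_on_link_sum continuous_intros) auto
  then have comp: "compact (\<Union>i\<in>verts H. (\<lambda>x. link_sum H x i) ` K i)"
    using HD(1) by (intro compact_UN compact_continuous_image continuous_on_link_sum)
  have "{\<mu>. hgraph_eigenvalue k H \<mu>} = (\<Union>i\<in>verts H. (\<lambda>x. link_sum H x i) ` K i)"
  proof (intro equalityI subsetI)
    fix \<mu> assume "\<mu> \<in> {\<mu>. hgraph_eigenvalue k H \<mu>}"
    then obtain x where x: "\<exists>i\<in>verts H. x i \<noteq> 0"
      and eq: "\<And>i. i \<in> verts H \<Longrightarrow> link_sum H x i = \<mu> * x i ^ (k - 1)"
      using hgraph_eigenvalue_iff[OF H k] by auto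
    obtain i where i: "i \<in> verts H" and max: "\<And>j. j \<in> verts H \<Longrightarrow> norm (x j) \<le> norm (x i)"
      using ex_maximal_value[OF HD(1,2), of "\<lambda>j. norm (x j)"] by blast
    have nz: "x i \<noteq> 0"
      using x max by fastforce
    define z where "z j = (if j \<in> verts H then x j / x i else 0)" for j
    have zeq: "link_sum H z j = \<mu> * z j ^ (k - 1)" if "j \<in> verts H" for j
    proof -
      have "link_sum H z j = link_sum H (\<lambda>j. inverse (x i) * x j) j"
        by (rule link_sum_cong[OF H]) (simp add: z_def field_simps)
      also have "\<dots> = inverse (x i) ^ (k - 1) * (\<mu> * x j ^ (k - 1))"
        by (simp add: link_sum_scale[OF H] eq that)
      finally show ?thesis
        using that by (simp add: z_def divide_inverse power_mult_distrib mult_ac)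
    qed
    have zi: "z i = 1" using i nz by (simp add: z_def)
    have "\<mu> = link_sum H z i"
      using zeq[OF i] zi by simp
    moreover have "z \<in> K i"
      using zeq zi i max nz by (auto simp: K_def z_def norm_divide divide_le_eq_1)
    ultimately show "\<mu> \<in> (\<Union>i\<in>verts H. (\<lambda>x. link_sum H x i) ` K i)"
      using i by blast
  next
    fix \<mu> assume "\<mu> \<in> (\<Union>i\<in>verts H. (\<lambda>x. link_sum H x i) ` K i)"
    then obtain i x where i: "i \<in> verts H" and x: "x \<in> K i" and \<mu>: "\<mu> = link_sum H x i"
      by auto
    have "x i \<noteq> 0" using x by (simp add: K_def)
    moreover have "\<forall>j\<in>verts H. link_sum H x j = \<mu> * x j ^ (k - 1)"
      using x \<mu> by (auto simp: K_def)
    ultimately show "\<mu> \<in> {\<mu>. hgraph_eigenvalue k H \<mu>}"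
      using i hgraph_eigenvalue_iff[OF H k] by auto
  qed
  with comp show ?thesis by simp
qed

text \<open>The indicator of a single vertex \<open>u\<close> is an eigenvector: since
  \<open>k\<close> is at least 3, each edge has a vertex other than \<open>i\<close> and
  \<open>u\<close>, where the indicator vanishes. This makes the set of eigenvalues
  nonempty.\<close>

lemma zero_eigenvalue:
  assumes H: "multi_kgraph k H" and k: "k \<ge> 3"
  shows "hgraph_eigenvalue k H 0"
proof -
  note HD = multi_kgraphD[OF H]
  obtain u where u: "u \<in> verts H" using HD(2) by auto
  define x :: "'a \<Rightarrow> complex" where "x v = (if v = u then 1 else 0)" for v
  have "link_sum H x i = 0" for i
  proof -
    have "prod x (e - {i}) = 0" if "e \<in># edges H" for e
    proof -
      have "card {i, u} \<le> 2"
        by (simp add: card_insert_if)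
      then have "\<not> e \<subseteq> {i, u}"
        using HD(4)[OF that] k card_mono[of "{i, u}" e] by auto
      then obtain v where "v \<in> e" "v \<noteq> i" "v \<noteq> u"
        by auto
      then show ?thesis
        using HD(5)[OF that] by (auto simp: x_def intro!: prod_zero)
    qed
    then show ?thesis
      unfolding link_sum_def by (auto intro!: sum_mset.neutral)
  qed
  then show ?thesis
    using u k hgraph_eigenvalue_iff[OF H] by (auto simp: x_def intro!: exI[of _ x] bexI[of _ u])
qed

text \<open>The \<open>GREATEST\<close> in \<open>rho\<close> is meaningful only if a maximum
  exists; compactness and nonemptiness of the set of eigenvalues supply it.\<close>

lemma rho_attained:
  assumes H: "multi_kgraph k H" and k: "k \<ge> 3"
  obtains \<mu> where "hgraph_eigenvalue k H \<mu>" "rho k H = cmod \<mu>"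
proof -
  have "compact (cmod ` {\<mu>. hgraph_eigenvalue k H \<mu>})"
    using H k by (intro compact_continuous_image compact_eigenvalues continuous_intros) auto
  moreover have "cmod ` {\<mu>. hgraph_eigenvalue k H \<mu>} \<noteq> {}"
    using zero_eigenvalue[OF H k] by auto
  ultimately obtain r where r: "r \<in> cmod ` {\<mu>. hgraph_eigenvalue k H \<mu>}"
    "\<forall>s\<in>cmod ` {\<mu>. hgraph_eigenvalue k H \<mu>}. s \<le> r"
    using compact_attains_sup by metis
  then have "rho k H = r"
    unfolding rho_def by (intro Greatest_equality) auto
  with r(1) that show ?thesis
    by auto
qed

lemma kgraph_edges_eq_mset_set:
  assumes "kgraph k H"
  shows "edges H = mset_set (set_mset (edges H))"
proof (rule multiset_eqI)
  fix e
  have "count (edges H) e \<le> 1"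
    using assms by (simp add: kgraph_def)
  then show "count (edges H) e = count (mset_set (set_mset (edges H))) e"
    by (cases "e \<in># edges H") (auto simp: not_in_iff Suc_le_eq le_antisym)
qed

text \<open>The set \<open>\<phi> e\<close> may differ from \<open>e\<close> as long as the product of the entries of the vector does not
  decrease. This allows edges to be moved towards the largest entry.\<close>

lemma rho_less_root:
  assumes H: "kgraph k H" and k: "k \<ge> 3" and t: "t > 0"
    and lab: "\<And>(y :: 'a \<Rightarrow> real) u. (\<And>v. y v \<ge> 0) \<Longrightarrow> u \<in> verts H \<Longrightarrow> y u > 0 \<Longrightarrow>
      (\<And>v. v \<in> verts H \<Longrightarrow> y v \<le> y u) \<Longrightarrow>
      \<exists>\<phi> B. (\<forall>e\<in>set_mset (edges H). prod y e \<le> prod y (\<phi> e) \<and> \<phi> e \<subseteq> verts H \<and> card (\<phi> e) = k \<and>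
            (\<forall>v\<in>\<phi> e. B v e > 0) \<and> t * (\<Prod>v\<in>\<phi> e. B v e) \<ge> 1) \<and>
          (\<forall>v\<in>verts H. (\<Sum>e | e \<in># edges H \<and> v \<in> \<phi> e. B v e) \<le> 1) \<and>
          (\<Sum>e | e \<in># edges H \<and> u \<in> \<phi> e. B u e) < (1 :: real)"
  shows "rho k H < root k t"
proof -
  have mH: "multi_kgraph k H" using H by (simp add: kgraph_def)
  note HD = multi_kgraphD[OF mH]
  have k1: "k \<ge> 1" using k by simp
  define E where "E = set_mset (edges H)"
  have EH: "edges H = mset_set E"
    unfolding E_def by (rule kgraph_edges_eq_mset_set[OF H])
  have sumE: "(\<Sum>e\<in>#edges H. g e) = (\<Sum>e\<in>E. g e)" for g :: "'a set \<Rightarrow> real"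
    by (simp add: EH sum_unfold_sum_mset)
  obtain \<mu> where \<mu>: "hgraph_eigenvalue k H \<mu>" "rho k H = cmod \<mu>"
    using rho_attained[OF mH k] by blast
  obtain y where y: "\<And>i. y i \<ge> 0" "\<exists>i\<in>verts H. y i > 0"
    "cmod \<mu> * (\<Sum>i\<in>verts H. y i ^ k) \<le> real k * (\<Sum>e\<in>#edges H. prod y e)"
    using eigenvalue_moduli[OF mH k1 \<mu>(1)] by metis
  obtain u where u: "u \<in> verts H" "\<And>v. v \<in> verts H \<Longrightarrow> y v \<le> y u"
    using ex_maximal_value[OF HD(1,2), of y] by blast
  have yu: "y u > 0"
    using u y(2) by fastforce
  obtain \<phi> B where \<phi>: "\<And>e. e \<in> E \<Longrightarrow> prod y e \<le> prod y (\<phi> e)" "\<And>e. e \<in> E \<Longrightarrow> \<phi> e \<subseteq> verts H"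
      "\<And>e. e \<in> E \<Longrightarrow> card (\<phi> e) = k"
    and B: "\<And>e v. e \<in> E \<Longrightarrow> v \<in> \<phi> e \<Longrightarrow> B v e > 0" "\<And>e. e \<in> E \<Longrightarrow> t * (\<Prod>v\<in>\<phi> e. B v e) \<ge> 1"
    and le: "\<And>v. v \<in> verts H \<Longrightarrow> (\<Sum>e | e \<in> E \<and> v \<in> \<phi> e. B v e) \<le> 1"
    and less: "(\<Sum>e | e \<in> E \<and> u \<in> \<phi> e. B u e) < 1"
    using lab[of y, OF y(1) u(1) yu u(2)] unfolding E_def by blast
  have S: "(\<Sum>e\<in>#edges H. if v \<in> \<phi> e then B v e else 0) = (\<Sum>e | e \<in> E \<and> v \<in> \<phi> e. B v e)" for v
    unfolding sumE by (simp add: sum.inter_filter E_def)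
  have "cmod \<mu> * (\<Sum>i\<in>verts H. y i ^ k) \<le> real k * (\<Sum>e\<in>E. prod y e)"
    using y(3) by (simp only: sumE)
  also have "\<dots> \<le> real k * (\<Sum>e\<in>#edges H. prod y (\<phi> e))"
    unfolding sumE by (intro mult_left_mono sum_mono \<phi>(1)) auto
  also have "\<dots> \<le> root k t * (\<Sum>v\<in>verts H. y v ^ k * (\<Sum>e\<in>#edges H. if v \<in> \<phi> e then B v e else 0))"
    using HD \<phi> B y(1) k t by (intro labelling_sum_bound) (auto simp: E_def)
  also have "\<dots> = root k t * (\<Sum>v\<in>verts H. y v ^ k * (\<Sum>e | e \<in> E \<and> v \<in> \<phi> e. B v e))"
    by (simp only: S)
  \<comment> \<open>Strictness comes from the vertex \<open>u\<close> alone, where the total label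
    is below 1 and \<open>y u\<close> is positive.\<close>
  also have "\<dots> < root k t * (\<Sum>v\<in>verts H. y v ^ k * 1)"
  proof (intro mult_strict_left_mono sum_strict_mono_ex1 HD(1) ballI)
    show "y v ^ k * (\<Sum>e | e \<in> E \<and> v \<in> \<phi> e. B v e) \<le> y v ^ k * 1" if "v \<in> verts H" for v
      using y(1) le[OF that] by (intro mult_left_mono) auto
    show "\<exists>v\<in>verts H. y v ^ k * (\<Sum>e | e \<in> E \<and> v \<in> \<phi> e. B v e) < y v ^ k * 1"
      using u(1) yu less by (intro bexI[of _ u] mult_strict_left_mono) auto
    show "root k t > 0" using t k by simp
  qed
  finally have "cmod \<mu> * (\<Sum>i\<in>verts H. y i ^ k) < root k t * (\<Sum>i\<in>verts H. y i ^ k)"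
    by simp
  moreover have "(\<Sum>i\<in>verts H. y i ^ k) > 0"
    using y(1) u(1) yu HD(1) by (auto intro!: sum_pos2)
  ultimately show ?thesis
    using \<mu>(2) by (simp add: mult_less_cancel_right)
qed

section \<open>Hypergraphs with a core\<close>

text \<open>When all vertices outside \<open>C\<close> have degree 1, the edge size and the traces
  of the edges on \<open>C\<close> determine the hypergraph up to isomorphism. The traces form a
  multiset because different edges may have the same trace.\<close>

definition core_traces :: "'a hgraph \<Rightarrow> 'a set \<Rightarrow> 'a set multiset \<Rightarrow> bool" where
  "core_traces H C T \<longleftrightarrow> C \<subseteq> verts H \<and> (\<forall>x\<in>verts H - C. size {#e \<in># edges H. x \<in> e#} = 1) \<and>
     {#e \<inter> C. e \<in># edges H#} = T"

text \<open>By induction on the edges, \<open>e\<close> is matched with an edge \<open>e'\<close>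
  whose trace is the image of the trace of \<open>e\<close>. The parts outside the cores then have
  equal size, and a bijection between them extends the map. Degrees are only required to be at most
  1, so that the hypothesis survives the removal of an edge.\<close>

lemma bij_betw_extend_core:
  assumes "bij_betw g C C'"
    and "{#g ` (e \<inter> C). e \<in># M#} = {#e \<inter> C'. e \<in># M'#}"
    and "\<And>e. e \<in># M \<Longrightarrow> finite e \<and> card e = k" "\<And>e. e \<in># M' \<Longrightarrow> finite e \<and> card e = k"
    and "\<And>x. x \<notin> C \<Longrightarrow> size {#e \<in># M. x \<in> e#} \<le> 1"
    and "\<And>x. x \<notin> C' \<Longrightarrow> size {#e \<in># M'. x \<in> e#} \<le> 1"
  shows "\<exists>f. bij_betw f (C \<union> \<Union>(set_mset M)) (C' \<union> \<Union>(set_mset M')) \<and> (\<forall>x\<in>C. f x = g x) \<and>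
    {#f ` e. e \<in># M#} = M'"
  using assms(2-)
proof (induction M arbitrary: M')
  case empty
  then have "M' = {#}" by (metis image_mset_is_empty_iff)
  with assms(1) show ?case by auto
next
  case (add e M)
  note inj_g = bij_betw_imp_inj_on[OF assms(1)]
  from add.prems(1) have "{#e \<inter> C'. e \<in># M'#} = add_mset (g ` (e \<inter> C)) {#g ` (e \<inter> C). e \<in># M#}"
    by simp
  then obtain e' M1 where M': "M' = add_mset e' M1" and e': "e' \<inter> C' = g ` (e \<inter> C)"
    and M1: "{#e \<inter> C'. e \<in># M1#} = {#g ` (e \<inter> C). e \<in># M#}"
    using msed_map_invR[of "\<lambda>e. e \<inter> C'" M'] by blast
  have deg: "size {#e \<in># M. x \<in> e#} \<le> 1" if "x \<notin> C" for x
  proof -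
    have "size {#e \<in># M. x \<in> e#} \<le> size {#d \<in># add_mset e M. x \<in> d#}" by simp
    with add.prems(4)[OF that] show ?thesis by linarith
  qed
  have deg': "size {#e \<in># M1. x \<in> e#} \<le> 1" if "x \<notin> C'" for x
  proof -
    have "size {#e \<in># M1. x \<in> e#} \<le> size {#d \<in># M'. x \<in> d#}" by (simp add: M')
    with add.prems(5)[OF that] show ?thesis by linarith
  qed
  have "\<exists>f. bij_betw f (C \<union> \<Union>(set_mset M)) (C' \<union> \<Union>(set_mset M1)) \<and> (\<forall>x\<in>C. f x = g x) \<and>
    {#f ` e. e \<in># M#} = M1"
    using add.prems(2,3) by (intro add.IH M1[symmetric] deg deg') (auto simp: M')
  then obtain f where f: "bij_betw f (C \<union> \<Union>(set_mset M)) (C' \<union> \<Union>(set_mset M1))"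
    "\<And>x. x \<in> C \<Longrightarrow> f x = g x" "{#f ` e. e \<in># M#} = M1"
    by auto
  have fin: "finite e" "card e = k" "finite e'" "card e' = k"
    using add.prems(2)[of e] add.prems(3)[of e'] by (auto simp: M')
  have "card (e' \<inter> C') = card (e \<inter> C)"
    unfolding e' by (rule card_image) (rule inj_on_subset[OF inj_g], auto)
  then have "card (e - C) = card (e' - C')"
    using fin by (simp add: card_Diff_subset_Int)
  then obtain h where h: "bij_betw h (e - C) (e' - C')"
    using fin by (meson bij_betw_iff_card finite_Diff)
  \<comment> \<open>Vertices of \<open>e\<close> outside the core lie in no other edge, so
    redefining the map on \<open>e - C\<close> does not disturb the edges already matched.\<close>
  have disj: "d \<inter> (e - C) = {}" if "d \<in># M" for d
  proof -
    have False if "x \<in> d" "x \<in> e - C" for x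
    proof -
      have "{#e \<in># M. x \<in> e#} = {#}"
        using add.prems(4)[of x] that by auto
      with \<open>d \<in># M\<close> \<open>x \<in> d\<close> show False
        by auto
    qed
    then show ?thesis by auto
  qed
  have disj': "d \<inter> (e' - C') = {}" if "d \<in># M1" for d
  proof -
    have False if "x \<in> d" "x \<in> e' - C'" for x
    proof -
      have "{#e \<in># M1. x \<in> e#} = {#}"
        using add.prems(5)[of x] that by (auto simp: M')
      with \<open>d \<in># M1\<close> \<open>x \<in> d\<close> show False
        by auto
    qed
    then show ?thesis by auto
  qed
  define f' where "f' x = (if x \<in> e - C then h x else f x)" for x
  have img: "f' ` d = f ` d" if "d \<in># M" for d
    using disj[OF that] by (intro image_cong) (auto simp: f'_def)
  have "bij_betw f' (C \<union> \<Union>(set_mset M)) (C' \<union> \<Union>(set_mset M1))"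
    using f(1) disj by (subst bij_betw_cong[of _ f' f]) (auto simp: f'_def)
  moreover have "bij_betw f' (e - C) (e' - C')"
    using h by (subst bij_betw_cong[of _ f' h]) (auto simp: f'_def)
  ultimately have "bij_betw f' ((C \<union> \<Union>(set_mset M)) \<union> (e - C)) ((C' \<union> \<Union>(set_mset M1)) \<union> (e' - C'))"
    using disj' by (intro bij_betw_combine[of f' "C \<union> \<Union>(set_mset M)"]) auto
  moreover have "(C \<union> \<Union>(set_mset M)) \<union> (e - C) = C \<union> \<Union>(set_mset (add_mset e M))"
    by auto
  moreover have "(C' \<union> \<Union>(set_mset M1)) \<union> (e' - C') = C' \<union> \<Union>(set_mset M')"
    by (auto simp: M')
  ultimately have bij: "bij_betw f' (C \<union> \<Union>(set_mset (add_mset e M))) (C' \<union> \<Union>(set_mset M'))"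
    by simp
  have f'C: "f' x = g x" if "x \<in> C" for x
    using f(2) that by (simp add: f'_def)
  have "f' ` e = f' ` (e \<inter> C) \<union> f' ` (e - C)"
    by blast
  also have "f' ` (e \<inter> C) = e' \<inter> C'"
    unfolding e' using f'C by (intro image_cong) auto
  also have "f' ` (e - C) = e' - C'"
    using h by (simp add: f'_def bij_betw_def)
  finally have "f' ` e = e'" by blast
  moreover have "{#f' ` e. e \<in># M#} = M1"
    unfolding f(3)[symmetric] by (rule image_mset_cong) (rule img)
  ultimately show ?case
    using bij f'C by (auto simp: M' intro!: exI[of _ f'])
qed

lemma core_traces_verts:
  assumes "multi_kgraph k H" "core_traces H C T"
  shows "verts H = C \<union> \<Union>(set_mset (edges H))"
proof -
  have "\<exists>e. e \<in># edges H \<and> x \<in> e" if "x \<in> verts H - C" for x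
  proof -
    have "size {#e \<in># edges H. x \<in> e#} = 1"
      using assms(2) that by (simp add: core_traces_def)
    then have "{#e \<in># edges H. x \<in> e#} \<noteq> {#}"
      by force
    then show ?thesis
      unfolding filter_mset_eq_mempty_iff by blast
  qed
  moreover have "C \<subseteq> verts H"
    using assms(2) by (simp add: core_traces_def)
  ultimately show ?thesis
    using multi_kgraphD(3)[OF assms(1)] by blast
qed

lemma core_traces_degree_le:
  assumes "multi_kgraph k H" "core_traces H C T" "x \<notin> C"
  shows "size {#e \<in># edges H. x \<in> e#} \<le> 1"
proof (cases "x \<in> verts H")
  case True
  then show ?thesis using assms by (simp add: core_traces_def)
next
  case False
  then have "{#e \<in># edges H. x \<in> e#} = {#}"
    using multi_kgraphD(3)[OF assms(1)] by auto
  then show ?thesis by (simp only: size_empty)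
qed

text \<open>This reduces an isomorphism to a renaming \<open>g\<close> of the core under which the
  multisets of traces agree.\<close>

lemma core_traces_iso:
  assumes H: "multi_kgraph k H" "core_traces H C T"
    and G: "multi_kgraph k G" "core_traces G C' {#g ` \<tau>. \<tau> \<in># T#}" and g: "bij_betw g C C'"
  shows "hgraph_iso H G"
proof -
  have "{#g ` (e \<inter> C). e \<in># edges H#} = {#g ` \<tau>. \<tau> \<in># T#}"
    using H(2) by (auto simp: core_traces_def multiset.map_comp comp_def)
  then have "{#g ` (e \<inter> C). e \<in># edges H#} = {#e \<inter> C'. e \<in># edges G#}"
    using G(2) by (simp add: core_traces_def)
  then have "\<exists>f. bij_betw f (C \<union> \<Union>(set_mset (edges H))) (C' \<union> \<Union>(set_mset (edges G))) \<and>
      (\<forall>x\<in>C. f x = g x) \<and> {#f ` e. e \<in># edges H#} = edges G"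
    using g multi_kgraphD[OF H(1)] multi_kgraphD[OF G(1)]
      core_traces_degree_le[OF H] core_traces_degree_le[OF G]
    by (intro bij_betw_extend_core) auto
  then show ?thesis
    unfolding hgraph_iso_def core_traces_verts[OF H] core_traces_verts[OF G] by blast
qed

text \<open>The new vertices exceed \<open>Max (verts H)\<close> and hence are fresh: they have
  degree 1, and the new edge meets the core only in \<open>x\<close>.\<close>

lemma core_traces_attach_pendent:
  assumes H: "multi_kgraph k H" "core_traces H C T" and x: "x \<in> C" and k: "k \<ge> 1"
  shows "multi_kgraph k (attach_pendent k x H) \<and>
    core_traces (attach_pendent k x H) C (add_mset {x} T)"
proof -
  note HD = multi_kgraphD[OF H(1)]
  define N where "N = {Max (verts H) <.. Max (verts H) + (k - 1)}"
  have "v \<le> Max (verts H)" if "v \<in> verts H" for v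
    using HD(1) that by simp
  then have disj: "verts H \<inter> N = {}"
    by (fastforce simp: N_def)
  have CV: "C \<subseteq> verts H"
    using H(2) by (simp add: core_traces_def)
  have eq: "attach_pendent k x H = (verts H \<union> N, add_mset (insert x N) (edges H))"
    by (simp add: attach_pendent_def N_def Let_def)
  have "x \<notin> N" using x CV disj by auto
  then have "card (insert x N) = k"
    using k by (simp add: N_def)
  then have "multi_kgraph k (attach_pendent k x H)"
    using H(1) x CV by (auto simp: eq multi_kgraph_def N_def)
  moreover have "size {#e \<in># add_mset (insert x N) (edges H). v \<in> e#} = 1"
    if "v \<in> verts H \<union> N - C" for v
  proof (cases "v \<in> N")
    case True
    then have "v \<notin> verts H" using disj by auto
    then have "{#e \<in># edges H. v \<in> e#} = {#}"
      using HD(3) by auto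
    with True show ?thesis by simp
  next
    case False
    then show ?thesis
      using that x H(2) by (auto simp: core_traces_def)
  qed
  moreover have "insert x N \<inter> C = {x}"
    using x CV disj by auto
  ultimately show ?thesis
    using H(2) by (auto simp: eq core_traces_def)
qed

lemma core_traces_attach_pendents:
  assumes H: "multi_kgraph k H \<and> core_traces H C T" and x: "x \<in> C" and k: "k \<ge> 1"
  shows "multi_kgraph k ((attach_pendent k x ^^ a) H) \<and>
    core_traces ((attach_pendent k x ^^ a) H) C (T + replicate_mset a {x})"
proof (induction a)
  case (Suc a)
  then show ?case
    using core_traces_attach_pendent[OF conjunct1[OF Suc] conjunct2[OF Suc] x k] by simp
qed (use H in simp)

section \<open>The hypergraphs \<open>B2\<close> and \<open>B31\<close> and their spectral
  radii\<close>

lemma core_traces_B2: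
  assumes k: "k \<ge> 3"
  shows "multi_kgraph k (B2 k a b) \<and>
    core_traces (B2 k a b) {0, 1} (replicate_mset 3 {0, 1} + replicate_mset a {0} + replicate_mset b {1})"
proof -
  define H :: "nat hgraph" where "H = ({0..<3 * k - 4},
      {# {0, 1} \<union> {2..<k}, {0, 1} \<union> {k..<2 * k - 2}, {0, 1} \<union> {2 * k - 2..<3 * k - 4} #})"
  have "card ({0, 1} \<union> {i..<j}) = 2 + (j - i)" if "i \<ge> 2" for i j :: nat
    using that by (subst card_Un_disjoint) auto
  then have "multi_kgraph k H"
    using k by (auto simp: H_def multi_kgraph_def)
  moreover have "core_traces H {0, 1} (replicate_mset 3 {0, 1})"
  proof -
    have "({0, 1} \<union> {i..<j}) \<inter> {0, 1} = {0, 1}" for i j :: nat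
      by auto
    then have "{#e \<inter> {0, 1}. e \<in># edges H#} = replicate_mset 3 {0, 1}"
      by (simp only: H_def snd_conv image_mset_add_mset image_mset_empty) (simp add: numeral_3_eq_3)
    moreover have "size {#e \<in># edges H. x \<in> e#} = 1" if "x \<in> verts H - {0, 1}" for x
      using that k by (auto simp: H_def)
    moreover have "{0, 1} \<subseteq> verts H"
      using k by (auto simp: H_def)
    ultimately show ?thesis
      by (auto simp only: core_traces_def)
  qed
  ultimately show ?thesis
    unfolding B2_def H_def[symmetric] using k
    by (intro core_traces_attach_pendents conjI) auto
qed

text \<open>For \<open>k = 3\<close> both intervals in the definition are empty and the two edges
  coincide; the multiset of traces still counts them twice, so this case needs no separate
  treatment.\<close>

lemma core_traces_B31:
  assumes k: "k \<ge> 3"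
  shows "multi_kgraph k (B31 k a 0 0) \<and>
    core_traces (B31 k a 0 0) {0, 1, 2} (replicate_mset 2 {0, 1, 2} + replicate_mset a {0})"
proof -
  define H :: "nat hgraph" where "H = ({0..<2 * k - 3}, {# {0, 1, 2} \<union> {3..<k}, {0, 1, 2} \<union> {k..<2 * k - 3} #})"
  have "card ({0, 1, 2} \<union> {i..<j}) = 3 + (j - i)" if "i \<ge> 3" for i j :: nat
    using that by (subst card_Un_disjoint) auto
  then have "multi_kgraph k H"
    using k by (auto simp: H_def multi_kgraph_def)
  moreover have "core_traces H {0, 1, 2} (replicate_mset 2 {0, 1, 2})"
  proof -
    have "({0, 1, 2} \<union> {i..<j}) \<inter> {0, 1, 2} = {0, 1, 2}" for i j :: nat
      by auto
    then have "{#e \<inter> {0, 1, 2}. e \<in># edges H#} = replicate_mset 2 {0, 1, 2}"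
      by (simp only: H_def snd_conv image_mset_add_mset image_mset_empty) (simp add: numeral_2_eq_2)
    moreover have "size {#e \<in># edges H. x \<in> e#} = 1" if "x \<in> verts H - {0, 1, 2}" for x
      using that k by (auto simp: H_def)
    moreover have "{0, 1, 2} \<subseteq> verts H"
      using k by (auto simp: H_def)
    ultimately show ?thesis
      by (auto simp only: core_traces_def)
  qed
  ultimately show ?thesis
    unfolding B31_def H_def[symmetric] funpow.simps id_apply using k
    by (intro core_traces_attach_pendents conjI) auto
qed

lemma sum_mset_edges_core:
  assumes "core_traces H C T" "v \<in> C"
  shows "(\<Sum>e\<in>#edges H. if v \<in> e then F (e \<inter> C) else 0) = (\<Sum>\<tau>\<in>#T. if v \<in> \<tau> then F \<tau> else 0)"
proof -
  have "T = {#e \<inter> C. e \<in># edges H#}"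
    using assms(1) by (simp add: core_traces_def)
  then show ?thesis
    using assms(2) by (simp add: multiset.map_comp comp_def)
qed

lemma sum_mset_edges_outside_core:
  assumes "core_traces H C T" "v \<in> verts H - C" "e \<in># edges H" "v \<in> e"
  shows "(\<Sum>e\<in>#edges H. if v \<in> e then f e else 0) = (f e :: real)"
proof -
  have 1: "size {#e \<in># edges H. v \<in> e#} = 1"
    using assms by (simp add: core_traces_def)
  then obtain d where d: "{#e \<in># edges H. v \<in> e#} = {#d#}"
    using size_1_singleton_mset by blast
  moreover have "e \<in># {#e \<in># edges H. v \<in> e#}"
    using assms by simp
  ultimately have "{#e \<in># edges H. v \<in> e#} = {#e#}"
    by auto
  moreover have "(\<Sum>e\<in>#M. if v \<in> e then f e else 0) = (\<Sum>e\<in>#{#e \<in># M. v \<in> e#}. f e)" for M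
    by (induction M) auto
  ultimately show ?thesis by simp
qed

text \<open>A vertex outside the core lies in one edge \<open>e\<close> only, so its sum is
  \<open>f e\<close> itself. The \<open>k - card \<tau>\<close> such vertices of an edge with trace
  \<open>\<tau>\<close> contribute that power of \<open>F \<tau>\<close>, which leaves one equation
  per trace.\<close>

lemma rho_core_traces:
  fixes F :: "'a set \<Rightarrow> real"
  assumes H: "multi_kgraph k H" "core_traces H C T" and k: "k \<ge> 1" and t: "t > 0"
    and F: "\<And>\<tau>. \<tau> \<in># T \<Longrightarrow> F \<tau> > 0"
    and S: "\<And>v. v \<in> C \<Longrightarrow> S v = (\<Sum>\<tau>\<in>#T. if v \<in> \<tau> then F \<tau> else 0)"
    and pos: "\<And>v. v \<in> C \<Longrightarrow> S v > 0"
    and eq: "\<And>\<tau>. \<tau> \<in># T \<Longrightarrow> t * F \<tau> ^ k = prod S \<tau> * F \<tau> ^ (k - card \<tau>)"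
  shows "rho k H = root k t"
proof (rule rho_eq_root[OF H(1) k t])
  note HD = multi_kgraphD[OF H(1)]
  define f where "f e = F (e \<inter> C)" for e
  define S' where "S' v = (\<Sum>e\<in>#edges H. if v \<in> e then f e else 0)" for v
  have T: "e \<inter> C \<in># T" if "e \<in># edges H" for e
    using H(2) that by (auto simp: core_traces_def)
  show fpos: "f e > 0" if "e \<in># edges H" for e
    using F T[OF that] by (simp add: f_def)
  show "S' v = (\<Sum>e\<in>#edges H. if v \<in> e then f e else 0)" for v
    by (simp add: S'_def)
  have inC: "S' v = S v" if "v \<in> C" for v
    unfolding S'_def f_def S[OF that] by (rule sum_mset_edges_core[OF H(2) that])
  have outC: "S' v = f e" if "e \<in># edges H" "v \<in> e - C" for e v
    unfolding S'_def using that HD(3) by (intro sum_mset_edges_outside_core[OF H(2)]) auto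
  show "S' v > 0" if v: "v \<in> verts H" for v
  proof (cases "v \<in> C")
    case True
    then show ?thesis using pos inC by simp
  next
    case False
    then obtain e where "e \<in># edges H" "v \<in> e - C"
      using v unfolding core_traces_verts[OF H] by blast
    then show ?thesis using outC fpos by simp
  qed
  show "t * f e ^ k = prod S' e" if e: "e \<in># edges H" for e
  proof -
    have "prod S' e = prod S' (e \<inter> C) * prod S' (e - C)"
      using prod.Int_Diff[OF HD(5)[OF e]] by blast
    also have "prod S' (e \<inter> C) = prod S (e \<inter> C)"
      using inC by (intro prod.cong) auto
    also have "prod S' (e - C) = (\<Prod>v\<in>e - C. f e)"
      using outC[OF e] by (intro prod.cong) auto
    also have "\<dots> = f e ^ (k - card (e \<inter> C))"
      using HD(4,5)[OF e] by (simp add: card_Diff_subset_Int)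
    finally show ?thesis
      using eq[OF T[OF e]] by (simp add: f_def)
  qed
qed

text \<open>Give the pendent edges at \<open>0\<close> the value 1 and the three common edges the
  value \<open>c\<close>. The edge equations force the sums \<open>t\<close> at \<open>0\<close> and
  \<open>c\<^sup>2\<close> at \<open>1\<close>, and the value \<open>c\<^sup>2 / t\<close> on the
  pendent edges at \<open>1\<close>. The equation at \<open>1\<close> then yields
  \<open>c = 3 * t / (t - b)\<close>, and the one at \<open>0\<close> is the hypothesis on
  \<open>t\<close>.\<close>

lemma rho_B2:
  assumes k: "k \<ge> 3" and t: "t > real b" "real a + 9 * t / (t - real b) = t"
  shows "rho k (B2 k a b) = root k t"
proof -
  define c where "c = 3 * t / (t - real b)"
  have t0: "t > 0" using t(1) by linarith
  then have c0: "c > 0" using t by (simp add: c_def)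
  have 1: "3 * c + real a = t"
    using t by (simp add: c_def)
  have "3 * t + real b * c = c * t"
    using t by (simp add: c_def field_simps)
  then have "c * (3 * t + real b * c) = c * (c * t)"
    by simp
  then have 2: "3 * c + real b * (c\<^sup>2 / t) = c\<^sup>2"
    using t0 by (simp add: field_simps power2_eq_square)
  define F :: "nat set \<Rightarrow> real" where
    "F \<tau> = (if \<tau> = {0, 1} then c else if \<tau> = {0} then 1 else c\<^sup>2 / t)" for \<tau>
  define S :: "nat \<Rightarrow> real" where "S v = (if v = 0 then t else c\<^sup>2)" for v
  have neq: "{0, 1 :: nat} \<noteq> {0}" "{0, 1 :: nat} \<noteq> {1}" "{1 :: nat} \<noteq> {0, 1}" "{0 :: nat} \<noteq> {0, 1}"
    by auto
  have F': "F {0, 1} = c" "F {0} = 1" "F {1} = c\<^sup>2 / t"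
    using neq by (auto simp: F_def)
  have T: "\<tau> = {0, 1} \<or> \<tau> = {0} \<or> \<tau> = {1}" if "\<tau> \<in># replicate_mset 3 {0, 1} + replicate_mset a {0} + replicate_mset b {1}"
    for \<tau> :: "nat set"
    using that by (auto split: if_splits)
  have "k = 2 + (k - 2)"
    using k by simp
  then have "c ^ k = c ^ (2 + (k - 2))"
    by (rule arg_cong)
  then have k2: "c\<^sup>2 * c ^ (k - 2) = c ^ k"
    by (simp only: power_add)
  have k1: "(c\<^sup>2 / t) ^ k = c\<^sup>2 / t * (c\<^sup>2 / t) ^ (k - 1)"
    using k power_minus_mult[of k "c\<^sup>2 / t"] by (metis mult.commute neq0_conv not_numeral_le_zero)
  show ?thesis
  proof (rule rho_core_traces[where F = F and S = S])
    show "multi_kgraph k (B2 k a b)" 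
      "core_traces (B2 k a b) {0, 1} (replicate_mset 3 {0, 1} + replicate_mset a {0} + replicate_mset b {1})"
      using core_traces_B2[OF k] by auto
    show "F \<tau> > 0" for \<tau>
      using c0 t0 by (simp add: F_def)
    show "S v > 0" for v using c0 t0 by (simp add: S_def)
    show "S v = (\<Sum>\<tau>\<in>#replicate_mset 3 {0, 1} + replicate_mset a {0} + replicate_mset b {1}. if v \<in> \<tau> then F \<tau> else 0)"
      if "v \<in> {0, 1}" for v
      using that 1 2 F' by (auto simp: S_def)
    show "t * F \<tau> ^ k = prod S \<tau> * F \<tau> ^ (k - card \<tau>)"
      if "\<tau> \<in># replicate_mset 3 {0, 1} + replicate_mset a {0} + replicate_mset b {1}" for \<tau>
      using T[OF that]
    proof (elim disjE)
      assume \<tau>: "\<tau> = {0, 1}"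
      have "card {0, 1 :: nat} = 2" "prod S {0, 1} = t * c\<^sup>2"
        by (simp_all add: S_def)
      then show ?thesis
        unfolding \<tau> F' using k2 by (metis mult.assoc)
    next
      assume \<tau>: "\<tau> = {0}"
      show ?thesis
        unfolding \<tau> F' by (simp add: S_def)
    next
      assume \<tau>: "\<tau> = {1}"
      show ?thesis
        unfolding \<tau> F' k1 using t0 by (simp add: S_def)
    qed
  qed (use k t0 in auto)
qed

text \<open>With value 1 on the pendent edges and \<open>c\<close> on the two others, the sums at
  \<open>1\<close> and \<open>2\<close> are \<open>2 * c\<close>, and the edge equation
  \<open>c ^ 3 = (2 * c) ^ 2\<close> gives \<open>c = 4\<close>.\<close>

lemma rho_B31:
  assumes k: "k \<ge> 3"
  shows "rho k (B31 k a 0 0) = root k (real a + 8)"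
proof -
  define F :: "nat set \<Rightarrow> real" where "F \<tau> = (if \<tau> = {0} then 1 else 4)" for \<tau>
  define S :: "nat \<Rightarrow> real" where "S v = (if v = 0 then real a + 8 else 8)" for v
  have neq: "{0, 1, 2 :: nat} \<noteq> {0}"
    by auto
  have F': "F {0, 1, 2} = 4" "F {0} = 1"
    using neq by (auto simp: F_def)
  have T: "\<tau> = {0, 1, 2} \<or> \<tau> = {0}" if "\<tau> \<in># replicate_mset 2 {0, 1, 2} + replicate_mset a {0}"
    for \<tau> :: "nat set"
    using that by (auto split: if_splits)
  have k3: "(4 :: real) ^ k = 64 * 4 ^ (k - 3)"
    using k power_add[of "4 :: real" 3 "k - 3"] by simp
  show ?thesis
  proof (rule rho_core_traces[where F = F and S = S])
    show "multi_kgraph k (B31 k a 0 0)" 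
      "core_traces (B31 k a 0 0) {0, 1, 2} (replicate_mset 2 {0, 1, 2} + replicate_mset a {0})"
      using core_traces_B31[OF k] by auto
    show "F \<tau> > 0" for \<tau>
      by (simp add: F_def)
    show "S v > 0" for v by (simp add: S_def)
    show "S v = (\<Sum>\<tau>\<in>#replicate_mset 2 {0, 1, 2} + replicate_mset a {0}. if v \<in> \<tau> then F \<tau> else 0)"
      if "v \<in> {0, 1, 2}" for v
      using that F' by (auto simp: S_def)
    show "(real a + 8) * F \<tau> ^ k = prod S \<tau> * F \<tau> ^ (k - card \<tau>)"
      if "\<tau> \<in># replicate_mset 2 {0, 1, 2} + replicate_mset a {0}" for \<tau>
      using T[OF that]
    proof (elim disjE)
      assume \<tau>: "\<tau> = {0, 1, 2}"
      have "card {0, 1, 2 :: nat} = 3" "prod S {0, 1, 2} = (real a + 8) * 64"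
        by (simp_all add: S_def)
      then show ?thesis
        unfolding \<tau> F' k3 by (metis mult.assoc)
    next
      assume \<tau>: "\<tau> = {0}"
      show ?thesis
        unfolding \<tau> F' by (simp add: S_def)
    qed
  qed (use k in auto)
qed

section \<open>Moving edges to a root\<close>

text \<open>The labels at the root \<open>u\<close> are left out: they are determined by requiring the product of the
  labels of an edge to be \<open>1 / t\<close>.\<close>

definition rooted_labelling ::
  "nat \<Rightarrow> 'a hgraph \<Rightarrow> ('a \<Rightarrow> real) \<Rightarrow> 'a \<Rightarrow> real \<Rightarrow> ('a set \<Rightarrow> 'a set) \<Rightarrow> ('a \<Rightarrow> 'a set \<Rightarrow> real) \<Rightarrow> bool" where
  "rooted_labelling k H y u t \<phi> \<beta> \<longleftrightarrow>
     (\<forall>e\<in>set_mset (edges H). prod y e \<le> prod y (\<phi> e) \<and> \<phi> e \<subseteq> verts H \<and> card (\<phi> e) = k \<and>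
        (\<forall>v\<in>\<phi> e - {u}. \<beta> v e > 0) \<and> (u \<notin> \<phi> e \<longrightarrow> t * (\<Prod>v\<in>\<phi> e. \<beta> v e) \<ge> 1)) \<and>
     (\<forall>v\<in>verts H - {u}. (\<Sum>e | e \<in># edges H \<and> v \<in> \<phi> e. \<beta> v e) \<le> 1) \<and>
     (\<Sum>e | e \<in># edges H \<and> u \<in> \<phi> e. 1 / (\<Prod>v\<in>\<phi> e - {u}. \<beta> v e)) < t"

text \<open>Divided by \<open>t\<close>, the last condition of \<open>rooted_labelling\<close> says
  that the labels at \<open>u\<close> sum to less than 1, which is the strictness required by
  \<open>rho_less_root\<close>.\<close>

lemma rho_less_root_rooted:
  assumes H: "kgraph k H" and k: "k \<ge> 3" and t: "t > 0"
    and lab: "\<And>(y :: 'a \<Rightarrow> real) u. (\<And>v. y v \<ge> 0) \<Longrightarrow> u \<in> verts H \<Longrightarrow>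
      (\<And>v. v \<in> verts H \<Longrightarrow> y v \<le> y u) \<Longrightarrow> \<exists>\<phi> \<beta>. rooted_labelling k H y u t \<phi> \<beta>"
  shows "rho k H < root k t"
proof (rule rho_less_root[OF H k t])
  fix y :: "'a \<Rightarrow> real" and u
  assume "\<And>v. y v \<ge> 0" and u: "u \<in> verts H" and "\<And>v. v \<in> verts H \<Longrightarrow> y v \<le> y u"
  then obtain \<phi> \<beta> where lab: "rooted_labelling k H y u t \<phi> \<beta>"
    using assms(4) by blast
  define B where "B v e = (if v = u then 1 / (t * (\<Prod>v\<in>\<phi> e - {u}. \<beta> v e)) else \<beta> v e)" for v e
  have 1: "prod y e \<le> prod y (\<phi> e)" "\<phi> e \<subseteq> verts H" "card (\<phi> e) = k"
    "\<And>v. v \<in> \<phi> e - {u} \<Longrightarrow> \<beta> v e > 0" "u \<notin> \<phi> e \<Longrightarrow> t * (\<Prod>v\<in>\<phi> e. \<beta> v e) \<ge> 1" if "e \<in># edges H" for e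
    using lab that unfolding rooted_labelling_def by blast+
  have pos: "(\<Prod>v\<in>\<phi> e - {u}. \<beta> v e) > 0" if "e \<in># edges H" for e
    using 1(4)[OF that] by (intro prod_pos) auto
  have Bpos: "B v e > 0" if "e \<in># edges H" "v \<in> \<phi> e" for e v
    using pos[OF that(1)] t 1(4)[OF that(1)] that(2) by (auto simp: B_def)
  have Bt: "t * (\<Prod>v\<in>\<phi> e. B v e) \<ge> 1" if e: "e \<in># edges H" for e
  proof (cases "u \<in> \<phi> e")
    case True
    have fin: "finite (\<phi> e)"
      using 1(3)[OF e] k by (intro card_ge_0_finite) simp
    have "(\<Prod>v\<in>\<phi> e. B v e) = B u e * (\<Prod>v\<in>\<phi> e - {u}. B v e)"
      using fin True by (rule prod.remove)
    also have "(\<Prod>v\<in>\<phi> e - {u}. B v e) = (\<Prod>v\<in>\<phi> e - {u}. \<beta> v e)"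
      by (intro prod.cong) (auto simp: B_def)
    finally show ?thesis
      using pos[OF e] t by (simp add: B_def)
  next
    case False
    then have "(\<Prod>v\<in>\<phi> e. B v e) = (\<Prod>v\<in>\<phi> e. \<beta> v e)"
      by (intro prod.cong) (auto simp: B_def)
    then show ?thesis
      using 1(5)[OF e False] by simp
  qed
  have "(\<Sum>e | e \<in># edges H \<and> u \<in> \<phi> e. B u e)
      = (\<Sum>e | e \<in># edges H \<and> u \<in> \<phi> e. 1 / (\<Prod>v\<in>\<phi> e - {u}. \<beta> v e)) / t"
    unfolding sum_divide_distrib by (intro sum.cong) (auto simp: B_def)
  also have "\<dots> < 1"
    using lab t unfolding rooted_labelling_def by simp
  finally have Su: "(\<Sum>e | e \<in># edges H \<and> u \<in> \<phi> e. B u e) < 1" .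
  have "(\<Sum>e | e \<in># edges H \<and> v \<in> \<phi> e. B v e) \<le> 1" if "v \<in> verts H" for v
  proof (cases "v = u")
    case False
    then have "(\<Sum>e | e \<in># edges H \<and> v \<in> \<phi> e. B v e) = (\<Sum>e | e \<in># edges H \<and> v \<in> \<phi> e. \<beta> v e)"
      by (simp add: B_def)
    also have "\<dots> \<le> 1"
      using lab that False unfolding rooted_labelling_def by blast
    finally show ?thesis .
  qed (use Su in simp)
  with 1(1-3) Bpos Bt Su
  show "\<exists>\<phi> B. (\<forall>e\<in>set_mset (edges H). prod y e \<le> prod y (\<phi> e) \<and> \<phi> e \<subseteq> verts H \<and> card (\<phi> e) = k \<and>
            (\<forall>v\<in>\<phi> e. B v e > 0) \<and> t * (\<Prod>v\<in>\<phi> e. B v e) \<ge> 1) \<and>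
          (\<forall>v\<in>verts H. (\<Sum>e | e \<in># edges H \<and> v \<in> \<phi> e. B v e) \<le> 1) \<and>
          (\<Sum>e | e \<in># edges H \<and> u \<in> \<phi> e. B u e) < (1 :: real)"
    by (intro exI[of _ \<phi>] exI[of _ B]) blast
qed

section \<open>Distances from the root and the excess of the degrees\<close>

text \<open>The parent of an edge is one of its vertices at least distance from \<open>u\<close>. A
  vertex at distance \<open>n + 1\<close> shares an edge with a vertex at distance \<open>n\<close>
  and therefore is not the parent of that edge.\<close>

lemma hconnected_parents:
  assumes H: "multi_kgraph k H" "k \<ge> 1" and con: "hconnected H" and u: "u \<in> verts H"
  obtains p where "\<And>e. e \<in># edges H \<Longrightarrow> p e \<in> e" "\<And>e. e \<in># edges H \<Longrightarrow> u \<in> e \<Longrightarrow> p e = u"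
    "\<And>v. v \<in> verts H - {u} \<Longrightarrow> \<exists>e\<in>set_mset (edges H). v \<in> e - {p e}"
proof -
  note HD = multi_kgraphD[OF H(1)]
  define R where "R = {(x, y). \<exists>e\<in>set_mset (edges H). x \<in> e \<and> y \<in> e}"
  have "sym R" by (auto simp: R_def sym_def)
  then have symR: "sym (R\<^sup>*)" by (rule sym_rtrancl)
  have reach: "(u, v) \<in> R\<^sup>*" if v: "v \<in> verts H" for v
  proof -
    obtain vs es where path: "hpath H vs es" and "u \<in> set vs" "v \<in> set vs"
      using con u v unfolding hconnected_def by blast
    then obtain i j where i: "i < length vs" "vs ! i = u" and j: "j < length vs" "vs ! j = v"
      by (auto simp: in_set_conv_nth)
    have len: "length vs = Suc (length es)"
      using path by (simp add: hpath_def)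
    have 0: "(vs ! 0, vs ! n) \<in> R\<^sup>*" if "n < length vs" for n
      using that
    proof (induction n)
      case (Suc n)
      have n: "n < length es" using Suc.prems len by simp
      have "es ! n \<in># edges H"
        using path n unfolding hpath_def by (meson mset_subset_eqD nth_mem_mset)
      then have "(vs ! n, vs ! Suc n) \<in> R"
        using path n unfolding hpath_def R_def by blast
      then show ?case
        using Suc by (meson Suc_lessD rtrancl.rtrancl_into_rtrancl)
    qed simp
    \<comment> \<open>The path contains \<open>u\<close> but need not start there, so its initial
      piece is walked backwards.\<close>
    have "(u, vs ! 0) \<in> R\<^sup>*"
      using 0[OF i(1)] symR i(2) by (auto dest: symD)
    then show ?thesis
      using 0[OF j(1)] j(2) by (metis rtrancl_trans)
  qed
  define d where "d v = (LEAST n. (u, v) \<in> R ^^ n)" for v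
  have d: "(u, v) \<in> R ^^ d v" if "v \<in> verts H" for v
    unfolding d_def using rtrancl_imp_relpow[OF reach[OF that]] by (rule LeastI_ex)
  have d_le: "d v \<le> n" if "(u, v) \<in> R ^^ n" for v n
    unfolding d_def using that by (rule Least_le)
  define p where "p e = arg_min_on d e" for e
  have p: "p e \<in> e" "\<And>x. x \<in> e \<Longrightarrow> d (p e) \<le> d x" if "e \<in># edges H" for e
  proof -
    have "finite e" "e \<noteq> {}"
      using HD(4,5)[OF that] H(2) by auto
    then show "p e \<in> e" "\<And>x. x \<in> e \<Longrightarrow> d (p e) \<le> d x"
      using arg_min_if_finite[of e d] by (auto simp: p_def not_less)
  qed
  show ?thesis
  proof (rule that[of p])
    show "p e \<in> e" if "e \<in># edges H" for e
      using p(1)[OF that] .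
    show "p e = u" if "e \<in># edges H" "u \<in> e" for e
    proof -
      have "d u = 0" using d_le[of u 0] by simp
      then have "d (p e) = 0" using p(2)[OF that] by simp
      then show ?thesis
        using d[of "p e"] p(1) HD(3) that(1) by auto
    qed
    show "\<exists>e\<in>set_mset (edges H). v \<in> e - {p e}" if v: "v \<in> verts H - {u}" for v
    proof (cases "d v")
      case 0
      then show ?thesis using d[of v] v by auto
    next
      case (Suc n)
      then obtain w where w: "(u, w) \<in> R ^^ n" "(w, v) \<in> R"
        using d[of v] v by auto
      then obtain e where e: "e \<in># edges H" "w \<in> e" "v \<in> e"
        by (auto simp: R_def)
      have "d (p e) \<le> n"
        using p(2)[OF e(1,2)] d_le[OF w(1)] by simp
      then have "v \<noteq> p e" using Suc by auto
      with e show ?thesis by auto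
    qed
  qed
qed

text \<open>The excesses \<open>d x - 1\<close> sum to 2, so either one element has excess 2 or two
  elements have excess 1.\<close>

lemma sum_eq_card_plus_2:
  fixes d :: "'a \<Rightarrow> nat"
  assumes A: "finite A" and d: "\<And>x. x \<in> A \<Longrightarrow> d x \<ge> 1" and sum: "sum d A = card A + 2"
  obtains v where "v \<in> A" "d v = 3" "\<And>x. x \<in> A - {v} \<Longrightarrow> d x = 1"
  | v w where "v \<in> A" "w \<in> A" "v \<noteq> w" "d v = 2" "d w = 2" "\<And>x. x \<in> A - {v, w} \<Longrightarrow> d x = 1"
proof -
  define g where "g x = d x - 1" for x
  have dg: "d x = g x + 1" if "x \<in> A" for x
    using d[OF that] by (simp add: g_def)
  have "sum d A = sum g A + card A"
    using dg by (simp add: sum_Suc)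
  then have g2: "sum g A = 2" using sum by simp
  then obtain v where v: "v \<in> A" "g v \<noteq> 0"
    by (metis sum.neutral zero_neq_numeral)
  have gv: "g v + sum g (A - {v}) = 2"
    using g2 sum.remove[OF A v(1), of g] by simp
  show ?thesis
  proof (cases "g v = 2")
    case True
    then have "g x = 0" if "x \<in> A - {v}" for x
      using gv that A by simp
    then show ?thesis
      using True v dg by (intro that(1)[of v]) auto
  next
    case False
    then have gv1: "g v = 1" "sum g (A - {v}) = 1"
      using gv v by auto
    then obtain w where w: "w \<in> A - {v}" "g w \<noteq> 0"
      by (metis sum.neutral zero_neq_one)
    have gw: "g w + sum g (A - {v} - {w}) = 1"
      using gv1 sum.remove[of "A - {v}" w g] A w by simp
    then have "g w = 1" "sum g (A - {v} - {w}) = 0"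
      using w by auto
    then have "g x = 0" if "x \<in> A - {v, w}" for x
      using that A by auto
    then show ?thesis
      using \<open>g w = 1\<close> gv1 v w dg by (intro that(2)[of v w]) auto
  qed
qed

lemma image_mset_const:
  assumes "finite A" "\<And>x. x \<in> A \<Longrightarrow> f x = c"
  shows "image_mset f (mset_set A) = replicate_mset (card A) c"
  using assms by (subst image_mset_cong[of _ f "\<lambda>_. c"]) (auto simp: image_mset_const_eq)

text \<open>Moving an edge to the root means replacing its parent by \<open>u\<close>; an edge
  through \<open>u\<close> has parent \<open>u\<close> and stays as it is. Three properties of the
  parents are enough, so their construction by distances is hidden.\<close>

locale rooted_hypergraph =
  fixes k :: nat and H :: "'a hgraph" and u :: 'a and p :: "'a set \<Rightarrow> 'a"
  assumes H: "kgraph k H" and k: "k \<ge> 3" and u: "u \<in> verts H"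
    and parent_in: "\<And>e. e \<in># edges H \<Longrightarrow> p e \<in> e"
    and parent_root: "\<And>e. e \<in># edges H \<Longrightarrow> u \<in> e \<Longrightarrow> p e = u"
    and parent_cover: "\<And>v. v \<in> verts H - {u} \<Longrightarrow> \<exists>e\<in>set_mset (edges H). v \<in> e - {p e}"
begin

definition E :: "'a set set" where "E = set_mset (edges H)"

definition children :: "'a set \<Rightarrow> 'a set" where "children e = e - {p e}"

text \<open>Only edges with \<open>v\<close> as a child are counted, so for \<open>v\<close> other
  than \<open>u\<close> this is the degree after all edges have been moved to the root.\<close>

definition deg :: "'a \<Rightarrow> nat" where "deg v = card {e \<in> E. v \<in> children e}"

text \<open>If every child has label \<open>1 / deg v\<close>, the root needs the label
  \<open>weight e / t\<close> to make the product over the moved edge equal to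
  \<open>1 / t\<close>.\<close>

definition weight :: "'a set \<Rightarrow> real" where "weight e = (\<Prod>v\<in>children e. real (deg v))"

lemma mH: "multi_kgraph k H"
  using H by (simp add: kgraph_def)

lemma finite_E [simp]: "finite E"
  by (simp add: E_def)

lemma edges_eq: "edges H = mset_set E"
  unfolding E_def by (rule kgraph_edges_eq_mset_set[OF H])

lemma finite_verts: "finite (verts H)"
  using multi_kgraphD[OF mH] by blast

lemma edge_subset: "e \<in> E \<Longrightarrow> e \<subseteq> verts H" and card_edge: "e \<in> E \<Longrightarrow> card e = k"
  and finite_edge: "e \<in> E \<Longrightarrow> finite e"
  using multi_kgraphD[OF mH] by (auto simp: E_def)

lemma parent_in_E: "e \<in> E \<Longrightarrow> p e \<in> e"
  using parent_in by (simp add: E_def)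

lemma parent_notin_children: "p e \<notin> children e"
  by (simp add: children_def)

lemma root_notin_children: "e \<in> E \<Longrightarrow> u \<notin> children e"
  using parent_root by (auto simp: E_def children_def)

lemma finite_children: "e \<in> E \<Longrightarrow> finite (children e)"
  using finite_edge by (simp add: children_def)

lemma children_subset: "e \<in> E \<Longrightarrow> children e \<subseteq> verts H - {u}"
  using edge_subset root_notin_children by (auto simp: children_def)

lemma card_children: "e \<in> E \<Longrightarrow> card (children e) = k - 1"
  using parent_in_E card_edge finite_edge by (simp add: children_def)

lemma deg_pos: "v \<in> verts H - {u} \<Longrightarrow> deg v \<ge> 1"
proof -
  assume "v \<in> verts H - {u}"
  then have "{e \<in> E. v \<in> children e} \<noteq> {}"
    using parent_cover by (auto simp: E_def children_def)
  then have "card {e \<in> E. v \<in> children e} > 0"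
    by (simp add: card_gt_0_iff)
  then show ?thesis
    by (simp add: deg_def)
qed

lemma deg_pos_child: "e \<in> E \<Longrightarrow> v \<in> children e \<Longrightarrow> deg v \<ge> 1"
  using deg_pos children_subset by blast

lemma weight_pos: "e \<in> E \<Longrightarrow> weight e > 0"
  unfolding weight_def using deg_pos_child by (intro prod_pos) force

text \<open>Every edge has \<open>k - 1\<close> children. In the bicyclic case the total exceeds the
  number of vertices other than \<open>u\<close> by 2, as \<open>sum_eq_card_plus_2\<close>
  demands.\<close>

lemma sum_deg: "sum deg (verts H - {u}) = card E * (k - 1)"
proof -
  have "sum deg (verts H - {u}) = (\<Sum>v\<in>verts H - {u}. \<Sum>e\<in>E. if v \<in> children e then 1 else 0)"
    by (intro sum.cong refl) (simp add: deg_def sum.If_cases Int_def)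
  also have "\<dots> = (\<Sum>e\<in>E. \<Sum>v\<in>verts H - {u}. if v \<in> children e then 1 else 0)"
    by (rule sum.swap)
  also have "\<dots> = (\<Sum>e\<in>E. k - 1)"
  proof (intro sum.cong refl)
    fix e assume e: "e \<in> E"
    have "(\<Sum>v\<in>verts H - {u}. if v \<in> children e then 1 else 0) = card ((verts H - {u}) \<inter> children e)"
      using finite_verts by (simp add: sum.If_cases)
    also have "(verts H - {u}) \<inter> children e = children e"
      using children_subset[OF e] by blast
    finally show "(\<Sum>v\<in>verts H - {u}. if v \<in> children e then 1 else 0) = k - 1"
      using card_children[OF e] by simp
  qed
  finally show ?thesis by simp
qed

lemma prod_move_le:
  fixes y :: "'a \<Rightarrow> real"
  assumes y: "\<And>v. y v \<ge> 0" "\<And>v. v \<in> verts H \<Longrightarrow> y v \<le> y u" and e: "e \<in> E"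
  shows "prod y e \<le> prod y (insert u (children e))"
proof -
  have "prod y e = y (p e) * prod y (children e)"
    using finite_edge[OF e] parent_in_E[OF e] by (simp add: children_def prod.remove)
  also have "\<dots> \<le> y u * prod y (children e)"
    using y parent_in_E[OF e] edge_subset[OF e] by (intro mult_right_mono prod_nonneg) auto
  also have "\<dots> = prod y (insert u (children e))"
    using finite_children[OF e] root_notin_children[OF e] by simp
  finally show ?thesis .
qed

lemma move_edge:
  assumes "e \<in> E"
  shows "insert u (children e) \<subseteq> verts H" "card (insert u (children e)) = k"
    "insert u (children e) - {u} = children e"
  using children_subset[OF assms] u card_children[OF assms] finite_children[OF assms]
    root_notin_children[OF assms] k by auto

lemma Collect_edges: "{e. e \<in># edges H \<and> P e} = {e \<in> E. P e}"
  by (simp add: E_def)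

section \<open>Labellings after moving edges to the root\<close>

text \<open>In the full star each vertex \<open>v\<close> other than \<open>u\<close> divides the
  total label 1 evenly among its \<open>deg v\<close> edges, and the root pays the sum of the
  weights divided by \<open>t\<close>.\<close>

lemma labelling_move_all:
  fixes y :: "'a \<Rightarrow> real"
  assumes y: "\<And>v. y v \<ge> 0" "\<And>v. v \<in> verts H \<Longrightarrow> y v \<le> y u" and t: "sum weight E < t"
  shows "rooted_labelling k H y u t (\<lambda>e. insert u (children e)) (\<lambda>v e. 1 / real (deg v))"
  unfolding rooted_labelling_def Collect_edges
proof (intro conjI ballI impI)
  fix e assume "e \<in># edges H"
  then have e: "e \<in> E" by (simp add: E_def)
  show "prod y e \<le> prod y (insert u (children e))"
    by (rule prod_move_le[of y, OF y e])
  show "insert u (children e) \<subseteq> verts H" "card (insert u (children e)) = k"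
    by (fact move_edge[OF e])+
  show "1 / real (deg v) > 0" if "v \<in> insert u (children e) - {u}" for v
    using deg_pos_child[OF e] that by force
next
  fix v assume v: "v \<in> verts H - {u}"
  have "{e \<in> E. v \<in> insert u (children e)} = {e \<in> E. v \<in> children e}"
    using v by auto
  then show "(\<Sum>e\<in>{e \<in> E. v \<in> insert u (children e)}. 1 / real (deg v)) \<le> 1"
    by (simp add: deg_def)
next
  have "(\<Sum>e\<in>{e \<in> E. u \<in> insert u (children e)}. 1 / (\<Prod>v\<in>insert u (children e) - {u}. 1 / real (deg v)))
      = (\<Sum>e\<in>E. weight e)"
    by (intro sum.cong) (auto simp: root_notin_children weight_def prod_dividef)
  with t show "(\<Sum>e\<in>{e \<in> E. u \<in> insert u (children e)}. 1 / (\<Prod>v\<in>insert u (children e) - {u}. 1 / real (deg v))) < t"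
    by simp
qed auto

text \<open>Every edge but \<open>e0\<close> is moved to the root. The edge \<open>e0\<close> hangs at the vertex \<open>p e0\<close>, which
  spends the label \<open>weight e0 / t\<close> on it; this scales its other labels by \<open>1 - weight e0 / t\<close>.\<close>

lemma labelling_move_all_but_one:
  fixes y :: "'a \<Rightarrow> real"
  assumes y: "\<And>v. y v \<ge> 0" "\<And>v. v \<in> verts H \<Longrightarrow> y v \<le> y u" and e0: "e0 \<in> E" "u \<notin> e0"
    and D: "weight e0 = D" "D < t"
    and A: "(\<Sum>e\<in>{e \<in> E. p e0 \<in> children e}. weight e) = A"
    and t: "sum weight E - D + A * (D / (t - D)) < t"
  shows "\<exists>\<phi> \<beta>. rooted_labelling k H y u t \<phi> \<beta>"
proof -
  define w where "w = p e0"
  define \<phi> where "\<phi> e = (if e = e0 then e0 else insert u (children e))" for e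
  define \<beta> where "\<beta> v e = (if v = w then if e = e0 then D / t else (1 - D / t) / real (deg w)
    else 1 / real (deg v))" for v e
  have w: "w \<in> e0" "w \<noteq> u" "w \<in> verts H" "w \<notin> children e0"
    using parent_in_E[OF e0(1)] e0 edge_subset[OF e0(1)] by (auto simp: w_def children_def)
  have D0: "D > 0" using weight_pos[OF e0(1)] D by simp
  have t0: "t > 0" using D D0 by simp
  have Dt: "D / t < 1" "1 - D / t > 0" using D t0 by auto
  have degw: "deg w \<ge> 1" using deg_pos w by auto
  have \<beta>pos: "\<beta> v e > 0" if "deg v \<ge> 1" for v e
    using that D0 t0 degw Dt by (auto simp: \<beta>_def)
  have \<phi>u: "\<phi> e - {u} = children e" if "e \<in> E" "e \<noteq> e0" for e
    using that move_edge(3) by (simp add: \<phi>_def)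
  have "rooted_labelling k H y u t \<phi> \<beta>"
    unfolding rooted_labelling_def Collect_edges
  proof (intro conjI ballI impI)
    fix e assume "e \<in># edges H"
    then have e: "e \<in> E" by (simp add: E_def)
    show "prod y e \<le> prod y (\<phi> e)"
      using prod_move_le[of y, OF y e] by (simp add: \<phi>_def)
    show sub: "\<phi> e \<subseteq> verts H" and "card (\<phi> e) = k"
      using move_edge[OF e] edge_subset[OF e] card_edge[OF e] by (auto simp: \<phi>_def)
    show "\<beta> v e > 0" if "v \<in> \<phi> e - {u}" for v
      using that sub by (intro \<beta>pos deg_pos) auto
    assume "u \<notin> \<phi> e"
    then have ee: "e = e0" by (auto simp: \<phi>_def split: if_splits)
    have "(\<Prod>v\<in>\<phi> e. \<beta> v e) = \<beta> w e0 * (\<Prod>v\<in>children e0. \<beta> v e0)"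
      using finite_edge[OF e0(1)] w(1) by (simp add: ee \<phi>_def children_def prod.remove[of e0 w] flip: w_def)
    also have "(\<Prod>v\<in>children e0. \<beta> v e0) = (\<Prod>v\<in>children e0. 1 / real (deg v))"
      using w by (intro prod.cong) (auto simp: \<beta>_def)
    also have "\<dots> = 1 / D"
      using D(1) by (simp add: weight_def prod_dividef)
    finally show "1 \<le> t * (\<Prod>v\<in>\<phi> e. \<beta> v e)"
      using D0 t0 by (simp add: \<beta>_def)
  next
    fix v assume v: "v \<in> verts H - {u}"
    show "(\<Sum>e\<in>{e \<in> E. v \<in> \<phi> e}. \<beta> v e) \<le> 1"
    proof (cases "v = w")
      case True
      have "{e \<in> E. w \<in> \<phi> e} = insert e0 {e \<in> E. w \<in> children e}"
        using w e0 by (auto simp: \<phi>_def)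
      moreover have "e0 \<notin> {e \<in> E. w \<in> children e}"
        using w by simp
      ultimately have "(\<Sum>e\<in>{e \<in> E. v \<in> \<phi> e}. \<beta> v e) = \<beta> w e0 + (\<Sum>e\<in>{e \<in> E. w \<in> children e}. \<beta> w e)"
        using True by simp
      also have "(\<Sum>e\<in>{e \<in> E. w \<in> children e}. \<beta> w e) = (\<Sum>e\<in>{e \<in> E. w \<in> children e}. (1 - D / t) / real (deg w))"
        using w by (intro sum.cong) (auto simp: \<beta>_def)
      also have "\<dots> = 1 - D / t"
        using degw unfolding sum_constant deg_def[symmetric] by simp
      finally show ?thesis by (simp add: \<beta>_def)
    next
      case False
      have "{e \<in> E. v \<in> \<phi> e} = {e \<in> E. v \<in> children e}"
        using False v by (auto simp: \<phi>_def children_def w_def split: if_splits)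
      then show ?thesis
        using False by (simp add: \<beta>_def deg_def)
    qed
  next
    \<comment> \<open>An edge with child \<open>w\<close> finds its label at \<open>w\<close> shrunk
      by the factor \<open>1 - D / t\<close>. The root makes up for this with
      \<open>weight e / (1 - D / t)\<close>, which is
      \<open>weight e * (1 + D / (t - D))\<close>.\<close>
    have *: "1 / (\<Prod>v\<in>\<phi> e - {u}. \<beta> v e) = weight e + (if w \<in> children e then weight e * (D / (t - D)) else 0)"
      if "e \<in> E - {e0}" for e
    proof (cases "w \<in> children e")
      case True
      have fin: "finite (children e)" using that finite_children by auto
      have "(\<Prod>v\<in>\<phi> e - {u}. \<beta> v e) = \<beta> w e * (\<Prod>v\<in>children e - {w}. \<beta> v e)"
        using that True fin by (simp add: \<phi>u prod.remove)
      also have "(\<Prod>v\<in>children e - {w}. \<beta> v e) = (\<Prod>v\<in>children e - {w}. 1 / real (deg v))"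
        by (intro prod.cong) (auto simp: \<beta>_def)
      also have "\<beta> w e = (1 - D / t) * (1 / real (deg w))"
        using that by (simp add: \<beta>_def)
      also have "(1 - D / t) * (1 / real (deg w)) * (\<Prod>v\<in>children e - {w}. 1 / real (deg v))
          = (1 - D / t) * (\<Prod>v\<in>children e. 1 / real (deg v))"
        using prod.remove[OF fin True, of "\<lambda>v. 1 / real (deg v)"] by simp
      also have "(\<Prod>v\<in>children e. 1 / real (deg v)) = 1 / weight e"
        by (simp add: weight_def prod_dividef)
      finally have "1 / (\<Prod>v\<in>\<phi> e - {u}. \<beta> v e) = weight e / (1 - D / t)"
        by simp
      also have "\<dots> = weight e * (1 + D / (t - D))"
        using t0 D by (simp add: field_simps)
      finally show ?thesis
        using True by (simp add: algebra_simps)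
    next
      case False
      have "(\<Prod>v\<in>\<phi> e - {u}. \<beta> v e) = (\<Prod>v\<in>children e. 1 / real (deg v))"
        using that False by (intro prod.cong) (auto simp: \<phi>u \<beta>_def)
      then show ?thesis
        using False by (simp add: weight_def prod_dividef)
    qed
    have "{e \<in> E. u \<in> \<phi> e} = E - {e0}"
      using e0 by (auto simp: \<phi>_def)
    then have "(\<Sum>e\<in>{e \<in> E. u \<in> \<phi> e}. 1 / (\<Prod>v\<in>\<phi> e - {u}. \<beta> v e))
        = (\<Sum>e\<in>E - {e0}. weight e + (if w \<in> children e then weight e * (D / (t - D)) else 0))"
      using * by simp
    also have "\<dots> = (\<Sum>e\<in>E - {e0}. weight e) + (\<Sum>e\<in>E - {e0}. if w \<in> children e then weight e * (D / (t - D)) else 0)"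
      by (rule sum.distrib)
    also have "(\<Sum>e\<in>E - {e0}. weight e) = sum weight E - D"
      using e0 D by (simp add: sum_diff1)
    also have "(\<Sum>e\<in>E - {e0}. if w \<in> children e then weight e * (D / (t - D)) else 0)
        = (\<Sum>e\<in>{e \<in> E. w \<in> children e}. weight e * (D / (t - D)))"
      using w by (intro sum.mono_neutral_cong_right) auto
    also have "\<dots> = A * (D / (t - D))"
      unfolding A[symmetric] w_def by (simp only: sum_distrib_right)
    finally show "(\<Sum>e\<in>{e \<in> E. u \<in> \<phi> e}. 1 / (\<Prod>v\<in>\<phi> e - {u}. \<beta> v e)) < t"
      using t by simp
  qed
  then show ?thesis by blast
qed

lemma sum_weight_bound:
  assumes "w \<in> verts H - {u}" "\<And>e. e \<in> E \<Longrightarrow> weight e \<le> c"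
  shows "(\<Sum>e\<in>{e \<in> E. w \<in> children e}. weight e) \<le> real (deg w) * c"
  using assms(2) by (auto simp: deg_def intro!: sum_bounded_above)

lemma size_edges_containing: "size {#e \<in># edges H. x \<in> e#} = card {e \<in> E. x \<in> e}"
proof -
  have "{#e \<in># mset_set E. x \<in> e#} = mset_set {e \<in> E. x \<in> e}"
    by (simp add: filter_mset_mset_set)
  then show ?thesis by (simp add: edges_eq)
qed

text \<open>This is the shape of \<open>B2\<close>, and no edge is moved. The vertex
  \<open>v\<close> spends \<open>1 / t\<close> on each of its \<open>b\<close> pendent edges and
  divides the rest among the three common edges; all other vertices have label 1. The root then pays
  1 for each of its pendent edges and \<open>3 / (1 - b / t)\<close> for each common edge, up to the
  factor \<open>1 / t\<close>.\<close>

lemma labelling_double_star: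
  fixes y :: "'a \<Rightarrow> real"
  assumes v: "v \<in> verts H" "v \<noteq> u"
    and deg1: "\<And>x. x \<in> verts H - {u, v} \<Longrightarrow> card {e \<in> E. x \<in> e} = 1"
    and Q: "card {e \<in> E. u \<in> e \<and> v \<in> e} = 3"
    and M: "\<And>e. e \<in> E \<Longrightarrow> u \<notin> e \<Longrightarrow> v \<in> e"
    and b: "real (card {e \<in> E. u \<notin> e}) = b" "b < t"
    and a: "real (card {e \<in> E. v \<notin> e}) = a"
    and t: "a + 9 * t / (t - b) < t"
  shows "\<exists>\<phi> \<beta>. rooted_labelling k H y u t \<phi> \<beta>"
proof -
  define \<beta> where "\<beta> x e = (if x = v then if u \<in> e then (1 - b / t) / 3 else 1 / t else 1)" for x and e :: "'a set"
  have b0: "b \<ge> 0" using b by auto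
  then have t0: "t > 0" and bt: "1 - b / t > 0" using b by (auto simp: field_simps)
  have \<beta>v: "(\<Prod>x\<in>e - X. \<beta> x e) = (if v \<in> e - X then \<beta> v e else 1)" if "e \<in> E" for e X
  proof (cases "v \<in> e - X")
    case True
    then have "(\<Prod>x\<in>e - X. \<beta> x e) = \<beta> v e * (\<Prod>x\<in>e - X - {v}. \<beta> x e)"
      using finite_edge[OF that] by (intro prod.remove) auto
    also have "(\<Prod>x\<in>e - X - {v}. \<beta> x e) = 1"
      by (intro prod.neutral) (auto simp: \<beta>_def)
    finally show ?thesis using True by simp
  next
    case False
    then have "(\<Prod>x\<in>e - X. \<beta> x e) = 1"
      by (intro prod.neutral) (auto simp: \<beta>_def)
    with False show ?thesis by (simp only: if_False)
  qed
  have "rooted_labelling k H y u t (\<lambda>e. e) \<beta>"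
    unfolding rooted_labelling_def Collect_edges
  proof (intro conjI ballI impI)
    fix e assume "e \<in># edges H"
    then have e: "e \<in> E" by (simp add: E_def)
    show "e \<subseteq> verts H" "card e = k"
      using edge_subset[OF e] card_edge[OF e] by auto
    show "\<beta> x e > 0" for x
      using t0 bt by (simp add: \<beta>_def)
    assume "u \<notin> e"
    then show "1 \<le> t * (\<Prod>v\<in>e. \<beta> v e)"
      using \<beta>v[OF e, of "{}"] M[OF e] t0 by (simp add: \<beta>_def)
  next
    fix x assume x: "x \<in> verts H - {u}"
    show "(\<Sum>e\<in>{e \<in> E. x \<in> e}. \<beta> x e) \<le> 1"
    proof (cases "x = v")
      case True
      have "{e \<in> E. v \<in> e} = {e \<in> E. u \<in> e \<and> v \<in> e} \<union> {e \<in> E. u \<notin> e}"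
        using M by auto
      then have "(\<Sum>e\<in>{e \<in> E. x \<in> e}. \<beta> x e)
          = (\<Sum>e\<in>{e \<in> E. u \<in> e \<and> v \<in> e}. \<beta> v e) + (\<Sum>e\<in>{e \<in> E. u \<notin> e}. \<beta> v e)"
        using True by (simp, intro sum.union_disjoint) auto
      also have "(\<Sum>e\<in>{e \<in> E. u \<in> e \<and> v \<in> e}. \<beta> v e) = (\<Sum>e\<in>{e \<in> E. u \<in> e \<and> v \<in> e}. (1 - b / t) / 3)"
        by (intro sum.cong) (auto simp: \<beta>_def)
      also have "\<dots> = 1 - b / t"
        unfolding sum_constant Q by simp
      also have "(\<Sum>e\<in>{e \<in> E. u \<notin> e}. \<beta> v e) = (\<Sum>e\<in>{e \<in> E. u \<notin> e}. 1 / t)"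
        by (intro sum.cong) (auto simp: \<beta>_def)
      also have "\<dots> = b / t"
        unfolding sum_constant b by simp
      finally show ?thesis by simp
    next
      case False
      then show ?thesis using deg1[of x] x by (simp add: \<beta>_def)
    qed
  next
    have "{e \<in> E. u \<in> e} = {e \<in> E. u \<in> e \<and> v \<in> e} \<union> {e \<in> E. v \<notin> e}"
      using M by auto
    then have "(\<Sum>e\<in>{e \<in> E. u \<in> e}. 1 / (\<Prod>x\<in>e - {u}. \<beta> x e))
        = (\<Sum>e\<in>{e \<in> E. u \<in> e \<and> v \<in> e}. 1 / (\<Prod>x\<in>e - {u}. \<beta> x e))
          + (\<Sum>e\<in>{e \<in> E. v \<notin> e}. 1 / (\<Prod>x\<in>e - {u}. \<beta> x e))"
      by (simp, intro sum.union_disjoint) auto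
    also have "(\<Sum>e\<in>{e \<in> E. u \<in> e \<and> v \<in> e}. 1 / (\<Prod>x\<in>e - {u}. \<beta> x e))
        = (\<Sum>e\<in>{e \<in> E. u \<in> e \<and> v \<in> e}. 3 / (1 - b / t))"
    proof (intro sum.cong refl)
      fix e assume "e \<in> {e \<in> E. u \<in> e \<and> v \<in> e}"
      then have e: "e \<in> E" "u \<in> e" "v \<in> e - {u}" using v by auto
      then show "1 / (\<Prod>x\<in>e - {u}. \<beta> x e) = 3 / (1 - b / t)"
        unfolding \<beta>v[OF e(1)] by (simp add: \<beta>_def)
    qed
    also have "\<dots> = 9 / (1 - b / t)"
      unfolding sum_constant Q by simp
    also have "\<dots> = 9 * t / (t - b)"
      using t0 b(2) by (simp add: field_simps)
    also have "(\<Sum>e\<in>{e \<in> E. v \<notin> e}. 1 / (\<Prod>x\<in>e - {u}. \<beta> x e)) = (\<Sum>e\<in>{e \<in> E. v \<notin> e}. 1)"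
      by (intro sum.cong) (auto simp: \<beta>v)
    also have "\<dots> = a"
      unfolding sum_constant a by simp
    finally show "(\<Sum>e\<in>{e \<in> E. u \<in> e}. 1 / (\<Prod>x\<in>e - {u}. \<beta> x e)) < t"
      using t by simp
  qed simp
  then show ?thesis by blast
qed

section \<open>Recognising the extremal hypergraphs by their traces\<close>

text \<open>The edges split into three classes with traces \<open>{u, v}\<close>, \<open>{u}\<close>
  and \<open>{v}\<close>. Both orders of \<open>a\<close> and \<open>b\<close> are provided because
  the root may be either of the two centres.\<close>

lemma iso_B2:
  assumes v: "v \<in> verts H" "v \<noteq> u"
    and deg1: "\<And>x. x \<in> verts H - {u, v} \<Longrightarrow> card {e \<in> E. x \<in> e} = 1"
    and Q: "card {e \<in> E. u \<in> e \<and> v \<in> e} = 3"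
    and M: "\<And>e. e \<in> E \<Longrightarrow> u \<notin> e \<Longrightarrow> v \<in> e"
    and a: "card {e \<in> E. v \<notin> e} = a" and b: "card {e \<in> E. u \<notin> e} = b"
  shows "hgraph_iso H (B2 k a b)" "hgraph_iso H (B2 k b a)"
proof -
  define T where "T = replicate_mset 3 {u, v} + replicate_mset a {u} + replicate_mset b {v}"
  have "E = {e \<in> E. u \<in> e \<and> v \<in> e} \<union> {e \<in> E. v \<notin> e} \<union> {e \<in> E. u \<notin> e}"
    using M by auto
  moreover have "mset_set ({e \<in> E. u \<in> e \<and> v \<in> e} \<union> {e \<in> E. v \<notin> e} \<union> {e \<in> E. u \<notin> e})
      = mset_set {e \<in> E. u \<in> e \<and> v \<in> e} + mset_set {e \<in> E. v \<notin> e} + mset_set {e \<in> E. u \<notin> e}"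
    using M by (subst mset_set_Union; auto)+
  ultimately have "mset_set E = mset_set {e \<in> E. u \<in> e \<and> v \<in> e} + mset_set {e \<in> E. v \<notin> e} + mset_set {e \<in> E. u \<notin> e}"
    by metis
  moreover have "image_mset (\<lambda>e. e \<inter> {u, v}) (mset_set {e \<in> E. u \<in> e \<and> v \<in> e}) = replicate_mset 3 {u, v}"
    unfolding Q[symmetric] by (rule image_mset_const) auto
  moreover have "image_mset (\<lambda>e. e \<inter> {u, v}) (mset_set {e \<in> E. v \<notin> e}) = replicate_mset a {u}"
    unfolding a[symmetric] using M by (intro image_mset_const) auto
  moreover have "image_mset (\<lambda>e. e \<inter> {u, v}) (mset_set {e \<in> E. u \<notin> e}) = replicate_mset b {v}"
    unfolding b[symmetric] using M by (intro image_mset_const) auto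
  ultimately have tr: "{#e \<inter> {u, v}. e \<in># edges H#} = T"
    unfolding edges_eq T_def by simp
  have core: "core_traces H {u, v} T"
    unfolding core_traces_def size_edges_containing using u v tr deg1 by auto
  have k0: "multi_kgraph k (B2 k a b)" "core_traces (B2 k a b) {0, 1} (replicate_mset 3 {0, 1} + replicate_mset a {0} + replicate_mset b {1})"
    for a b using core_traces_B2[OF k] by auto
  have "core_traces (B2 k a b) {0, 1} {#(\<lambda>x. if x = u then 0 else 1) ` \<tau>. \<tau> \<in># T#}"
    using k0(2)[of a b] v by (simp add: T_def insert_commute)
  then show "hgraph_iso H (B2 k a b)"
    by (rule core_traces_iso[OF mH core k0(1)]) (use v in \<open>auto simp: bij_betw_def inj_on_def\<close>)
  have "core_traces (B2 k b a) {0, 1} {#(\<lambda>x. if x = u then 1 else 0) ` \<tau>. \<tau> \<in># T#}"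
    using k0(2)[of b a] v by (simp add: T_def insert_commute ac_simps)
  then show "hgraph_iso H (B2 k b a)"
    by (rule core_traces_iso[OF mH core k0(1)]) (use v in \<open>auto simp: bij_betw_def inj_on_def\<close>)
qed

text \<open>Here every edge passes through the root, so only the traces \<open>{u, v, w}\<close> and
  \<open>{u}\<close> occur.\<close>

lemma iso_B31:
  assumes vw: "v \<in> verts H" "w \<in> verts H" "v \<noteq> u" "w \<noteq> u" "v \<noteq> w"
    and deg1: "\<And>x. x \<in> verts H - {u, v, w} \<Longrightarrow> card {e \<in> E. x \<in> e} = 1"
    and root: "\<And>e. e \<in> E \<Longrightarrow> u \<in> e"
    and Q: "card {e \<in> E. v \<in> e} = 2" "\<And>e. e \<in> E \<Longrightarrow> v \<in> e \<longleftrightarrow> w \<in> e"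
    and a: "card {e \<in> E. v \<notin> e} = a"
  shows "hgraph_iso H (B31 k a 0 0)"
proof -
  define T where "T = replicate_mset 2 {u, v, w} + replicate_mset a {u}"
  have "E = {e \<in> E. v \<in> e} \<union> {e \<in> E. v \<notin> e}"
    by auto
  moreover have "mset_set ({e \<in> E. v \<in> e} \<union> {e \<in> E. v \<notin> e})
      = mset_set {e \<in> E. v \<in> e} + mset_set {e \<in> E. v \<notin> e}"
    by (subst mset_set_Union; auto)
  ultimately have "mset_set E = mset_set {e \<in> E. v \<in> e} + mset_set {e \<in> E. v \<notin> e}"
    by metis
  moreover have "image_mset (\<lambda>e. e \<inter> {u, v, w}) (mset_set {e \<in> E. v \<in> e}) = replicate_mset 2 {u, v, w}"
    unfolding Q(1)[symmetric] using Q(2) root by (intro image_mset_const) auto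
  moreover have "image_mset (\<lambda>e. e \<inter> {u, v, w}) (mset_set {e \<in> E. v \<notin> e}) = replicate_mset a {u}"
    unfolding a[symmetric] using Q(2) root by (intro image_mset_const) auto
  ultimately have tr: "{#e \<inter> {u, v, w}. e \<in># edges H#} = T"
    unfolding edges_eq T_def by simp
  have core: "core_traces H {u, v, w} T"
    unfolding core_traces_def size_edges_containing using u vw tr deg1 by auto
  have k0: "multi_kgraph k (B31 k a 0 0)" "core_traces (B31 k a 0 0) {0, 1, 2} (replicate_mset 2 {0, 1, 2} + replicate_mset a {0})"
    using core_traces_B31[OF k] by auto
  have "core_traces (B31 k a 0 0) {0, 1, 2} {#(\<lambda>x. if x = u then 0 else if x = v then 1 else 2) ` \<tau>. \<tau> \<in># T#}"
    using k0(2) vw by (simp add: T_def insert_commute)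
  then show ?thesis
    by (rule core_traces_iso[OF mH core k0(1)]) (use vw in \<open>auto simp: bij_betw_def inj_on_def\<close>)
qed

section \<open>Case distinction on the excess of the degrees\<close>

text \<open>The total weight is \<open>m + 6\<close> if one vertex has degree 3, and
  \<open>m + 4 + q\<close> if two vertices have degree 2 and are both children in \<open>q\<close>
  edges. A total of at most \<open>m + 5\<close> is below \<open>t\<close>, so all edges can be
  moved. A total of \<open>m + 6\<close> is too large: then one edge is left in place, or none is
  moved because the shape of \<open>H\<close> is known.\<close>

lemma labelling_exists:
  fixes y :: "'a \<Rightarrow> real"
  assumes y: "\<And>v. y v \<ge> 0" "\<And>v. v \<in> verts H \<Longrightarrow> y v \<le> y u"
    and m: "card E = m" "m \<ge> 5" and bi: "card (verts H) + 1 = m * (k - 1)"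
    and t: "real m + 5 < t" "(t - real m - 5) * (t - 1) = 9"
    and iso: "\<not> hgraph_iso H (B2 k (m - 4) 1)" "\<not> hgraph_iso H (B2 k (m - 3) 0)"
      "\<not> hgraph_iso H (B31 k (m - 2) 0 0)"
  shows "\<exists>\<phi> \<beta>. rooted_labelling k H y u t \<phi> \<beta>"
proof -
  have t10: "t > 10" using t(1) m(2) by linarith
  have t9: "t = real m + 5 + 9 / (t - 1)"
    using t t10 by (simp add: field_simps)
  have but_one: ?thesis if "e0 \<in> E" "u \<notin> e0" "weight e0 < t"
    "sum weight E - weight e0 + (\<Sum>e\<in>{e \<in> E. p e0 \<in> children e}. weight e) * (weight e0 / (t - weight e0)) < t" for e0
    by (rule labelling_move_all_but_one[OF _ _ that(1,2) refl that(3) refl that(4)]) (use y in auto)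
  \<comment> \<open>Leaving an edge of weight 1 in place saves 1 and costs
    \<open>A / (t - 1)\<close>; by \<open>t9\<close> the result is below \<open>t\<close> as soon as
    \<open>A < 9\<close>.\<close>
  have D1: "sum weight E - 1 + A * (1 / (t - 1)) < t" if "sum weight E = real m + 6" "A < 9" for A
  proof -
    have "A / (t - 1) < 9 / (t - 1)"
      using that t10 by (simp add: divide_strict_right_mono)
    then show ?thesis using that(1) t9 by simp
  qed
  have "card (verts H - {u}) + 2 = m * (k - 1)"
    using bi card.remove[OF finite_verts u] by linarith
  then have "sum deg (verts H - {u}) = card (verts H - {u}) + 2"
    using sum_deg m by simp
  then show ?thesis
  proof (rule sum_eq_card_plus_2[of "verts H - {u}" deg, rotated 2])
    fix v assume v: "v \<in> verts H - {u}" "deg v = 3" and deg1: "\<And>x. x \<in> verts H - {u} - {v} \<Longrightarrow> deg x = 1"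
    have W: "weight e = (if v \<in> children e then 3 else 1)" if e: "e \<in> E" for e
    proof -
      have "weight e = (\<Prod>x\<in>children e. if x = v then 3 else 1)"
        unfolding weight_def using children_subset[OF e] deg1 v(2) by (intro prod.cong) auto
      then show ?thesis
        using finite_children[OF e] by (simp add: prod.delta)
    qed
    have "sum weight E = (\<Sum>e\<in>E. 1 + (if v \<in> children e then 2 else 0))"
      using W by (intro sum.cong) auto
    also have "\<dots> = real m + 2 * real (deg v)"
      using m by (simp add: sum.distrib sum.If_cases deg_def Int_def)
    finally have T: "sum weight E = real m + 6"
      using v by simp
    show ?thesis
    \<comment> \<open>An edge hanging at a vertex other than \<open>v\<close> is cheap to leave in
      place, since that vertex is a child in only one edge, of weight at most 3. If there is no such
      edge, \<open>H\<close> has the shape of \<open>B2\<close>.\<close>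
    proof (cases "\<exists>e0\<in>E. u \<notin> e0 \<and> p e0 \<noteq> v")
      case True
      then obtain e0 where e0: "e0 \<in> E" "u \<notin> e0" "p e0 \<noteq> v" by auto
      have w: "p e0 \<in> verts H - {u}"
        using e0 parent_in_E edge_subset by blast
      define A where "A = (\<Sum>e\<in>{e \<in> E. p e0 \<in> children e}. weight e)"
      have "A \<le> real (deg (p e0)) * 3"
        unfolding A_def using w W by (intro sum_weight_bound) auto
      moreover have "deg (p e0) = 1" using deg1 w e0 by blast
      ultimately have A: "A \<le> 3" by simp
      show ?thesis
      proof (rule but_one[OF e0(1,2)], goal_cases)
        case 1
        then show ?case using W[OF e0(1)] t10 by simp
      next
        case 2
        show ?case
        proof (cases "v \<in> children e0")
          case True
          \<comment> \<open>An edge of weight 3 saves 3 and costs less than 2, so the total falls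
            below \<open>m + 5\<close>.\<close>
          have "A * (3 / (t - 3)) \<le> 3 * (3 / (t - 3))"
            using A t10 by (intro mult_right_mono) auto
          also have "\<dots> < 2"
            using t10 by (simp add: field_simps)
          finally show ?thesis
            using T W[OF e0(1)] True t(1) by (simp flip: A_def)
        next
          case False
          then show ?thesis
            using D1[OF T, of A] A W[OF e0(1)] by (simp flip: A_def)
        qed
      qed
    next
      case False
      \<comment> \<open>An edge with child \<open>v\<close> does not have parent \<open>v\<close>
        and so contains \<open>u\<close>. Hence exactly three edges contain both vertices, and each
        of the others contains exactly one of them.\<close>
      then have pv: "p e = v" if "e \<in> E" "u \<notin> e" for e
        using that by blast
      have pu: "p e = u" if "e \<in> E" "u \<in> e" for e
        using parent_root that by (simp add: E_def)
      have vV: "v \<in> verts H" "v \<noteq> u" using v by auto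
      have Mv: "v \<in> e" if "e \<in> E" "u \<notin> e" for e
        using pv[OF that] parent_in_E[OF that(1)] by simp
      have ch: "{e \<in> E. x \<in> e} = {e \<in> E. x \<in> children e}" if "x \<noteq> u" "x \<noteq> v" for x
        using pv pu that unfolding children_def by blast
      have D: "card {e \<in> E. x \<in> e} = 1" if "x \<in> verts H - {u, v}" for x
        using ch[of x] deg1[of x] that by (simp add: deg_def)
      have "{e \<in> E. u \<in> e \<and> v \<in> e} = {e \<in> E. v \<in> children e}"
        using pv pu vV unfolding children_def by blast
      then have Q: "card {e \<in> E. u \<in> e \<and> v \<in> e} = 3"
        using v(2) by (simp add: deg_def)
      define a where "a = card {e \<in> E. v \<notin> e}"
      define b where "b = card {e \<in> E. u \<notin> e}"
      have "E = {e \<in> E. u \<in> e \<and> v \<in> e} \<union> ({e \<in> E. v \<notin> e} \<union> {e \<in> E. u \<notin> e})"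
        by auto
      moreover have "card ({e \<in> E. u \<in> e \<and> v \<in> e} \<union> ({e \<in> E. v \<notin> e} \<union> {e \<in> E. u \<notin> e})) = 3 + (a + b)"
        using Mv Q by (subst card_Un_disjoint, simp, simp, force, subst card_Un_disjoint) (auto simp: a_def b_def)
      ultimately have mab: "m = 3 + (a + b)"
        using m(1) by metis
      note iso_ab = iso_B2[OF vV D Q Mv a_def[symmetric] b_def[symmetric]]
      \<comment> \<open>As \<open>a + b = m - 3\<close>, any of these values would make
        \<open>H\<close> isomorphic to one of the excluded \<open>B2\<close> hypergraphs, in one of
        the two orders.\<close>
      have "b \<noteq> 0" "b \<noteq> 1" "a \<noteq> 0" "a \<noteq> 1"
        using iso_ab iso mab by (cases "a = 0"; cases "b = 0"; auto)+
      then have ab: "real a \<ge> 2" "real b \<ge> 2" by auto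
      have m': "real m = 3 + (real a + real b)" using mab by simp
      have tb: "t - real b > 10" using t(1) m' ab by linarith
      \<comment> \<open>The goal is \<open>9 * t < (t - a) * (t - b)\<close>; for
        \<open>b = 1\<close> the two sides would be equal by the equation for \<open>t\<close>.
        Writing \<open>t - a - 9\<close> as \<open>(t - a - b - 8) + (b - 1)\<close>, the first
        summand is evaluated by that equation and the second is estimated, which explains the factor
        \<open>b - 1\<close>.\<close>
      have "9 * t < 10 * (t - 1)" using t10 by simp
      also have "\<dots> < (t - real b) * (t - 1)"
        using tb t10 by (intro mult_strict_right_mono) auto
      finally have "(real b - 1) * (9 * t) < (real b - 1) * ((t - real b) * (t - 1))"
        using ab by (intro mult_strict_left_mono) auto
      moreover have "(t - real a - real b - 8) * (t - 1) = 9"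
        using t(2) by (simp add: m' algebra_simps)
      then have "(t - real b) * ((t - real a - real b - 8) * (t - 1)) = (t - real b) * 9"
        by simp
      ultimately have "(9 * real b) * (t - 1) < ((t - real b) * (t - real a - 9)) * (t - 1)"
        by (simp add: algebra_simps)
      then have "9 * real b < (t - real b) * (t - real a - 9)"
        using t10 by (simp add: mult_less_cancel_right)
      then have "9 * t < (t - real a) * (t - real b)"
        by (simp add: algebra_simps)
      then have "9 * t / (t - real b) < t - real a"
        using tb by (simp add: divide_less_eq)
      then have "real a + 9 * t / (t - real b) < t"
        by simp
      then show ?thesis
        using tb by (intro labelling_double_star[OF vV D Q Mv, of "real b" t "real a"]) (auto simp: a_def b_def)
    qed
  next
    fix v w assume vw: "v \<in> verts H - {u}" "w \<in> verts H - {u}" "v \<noteq> w" "deg v = 2" "deg w = 2"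
      and deg1: "\<And>x. x \<in> verts H - {u} - {v, w} \<Longrightarrow> deg x = 1"
    have W: "weight e = (if v \<in> children e then 2 else 1) * (if w \<in> children e then 2 else 1)" if e: "e \<in> E" for e
    proof -
      have "weight e = (\<Prod>x\<in>children e. (if x = v then 2 else 1) * (if x = w then 2 else 1))"
        unfolding weight_def using children_subset[OF e] deg1 vw by (intro prod.cong) auto
      then show ?thesis
        using finite_children[OF e] by (simp add: prod.delta prod.distrib)
    qed
    define q where "q = card {e \<in> E. v \<in> children e \<and> w \<in> children e}"
    have "sum weight E = (\<Sum>e\<in>E. 1 + (if v \<in> children e then 1 else 0) + (if w \<in> children e then 1 else 0)
        + (if v \<in> children e \<and> w \<in> children e then 1 else 0))"
      using W by (intro sum.cong) auto
    also have "\<dots> = real m + real (deg v) + real (deg w) + real q"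
      using m by (simp add: sum.distrib sum.If_cases deg_def Int_def q_def)
    finally have T: "sum weight E = real m + 4 + real q"
      using vw by simp
    show ?thesis
    proof (cases "q \<le> 1")
      case True
      then have "sum weight E < t" using T t(1) by simp
      then show ?thesis
        using labelling_move_all[of y, OF y] by blast
    next
      case False
      have sub: "{e \<in> E. v \<in> children e \<and> w \<in> children e} \<subseteq> {e \<in> E. v \<in> children e}"
        "{e \<in> E. v \<in> children e \<and> w \<in> children e} \<subseteq> {e \<in> E. w \<in> children e}"
        by auto
      have "q \<le> deg v"
        unfolding q_def deg_def by (intro card_mono sub) auto
      then have q2: "q = 2" using False vw by simp
      \<comment> \<open>Both edges with child \<open>v\<close> also have child \<open>w\<close> and
        conversely, so these two edges have weight 4 and all others weight 1.\<close>
      have "{e \<in> E. v \<in> children e \<and> w \<in> children e} = {e \<in> E. v \<in> children e}"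
        "{e \<in> E. v \<in> children e \<and> w \<in> children e} = {e \<in> E. w \<in> children e}"
        using q2 vw by (intro card_subset_eq sub; simp add: q_def deg_def)+
      then have vw_iff: "v \<in> children e \<longleftrightarrow> w \<in> children e" if "e \<in> E" for e
        using that by blast
      have W': "weight e = (if v \<in> children e then 4 else 1)" if "e \<in> E" for e
        using W vw_iff that by auto
      have T: "sum weight E = real m + 6" using T q2 by simp
      show ?thesis
      proof (cases "\<exists>e0\<in>E. u \<notin> e0")
        case True
        then obtain e0 where e0: "e0 \<in> E" "u \<notin> e0" by auto
        have x: "p e0 \<in> verts H - {u}"
          using e0 parent_in_E edge_subset by blast
        define A where "A = (\<Sum>e\<in>{e \<in> E. p e0 \<in> children e}. weight e)"
        have A: "A \<le> real (deg (p e0)) * 4"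
          unfolding A_def using x W' by (intro sum_weight_bound) auto
        show ?thesis
        proof (rule but_one[OF e0], goal_cases)
          case 1
          then show ?case using W'[OF e0(1)] t10 by simp
        next
          case 2
          show ?case
          proof (cases "v \<in> children e0")
            case True
            \<comment> \<open>Both \<open>v\<close> and \<open>w\<close> are children of this edge,
              so it hangs at a vertex of degree 1. It saves 4 and costs less than 3.\<close>
            then have "p e0 \<noteq> v" "p e0 \<noteq> w"
              using vw_iff[OF e0(1)] parent_notin_children by auto
            then have "deg (p e0) = 1" using deg1 x by blast
            then have "A * (4 / (t - 4)) \<le> 4 * (4 / (t - 4))"
              using A t10 by (intro mult_right_mono) auto
            also have "\<dots> < 3"
              using t10 by (simp add: field_simps)
            finally show ?thesis
              using T W'[OF e0(1)] True t(1) by (simp flip: A_def)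
          next
            case False
            \<comment> \<open>This edge may hang at \<open>v\<close> or \<open>w\<close>, whose two
              edges of weight 4 make \<open>A\<close> as large as 8, still below the 9 allowed by
              \<open>D1\<close>.\<close>
            have "deg (p e0) \<le> 2"
              using deg1 x vw by (cases "p e0 \<in> {v, w}") auto
            then have "real (deg (p e0)) * 4 \<le> 2 * 4"
              by (intro mult_right_mono) auto
            then have "A < 9" using A by linarith
            then show ?thesis
              using D1[OF T, of A] W'[OF e0(1)] False by (simp flip: A_def)
          qed
        qed
      next
        case False
        \<comment> \<open>With every edge through \<open>u\<close> nothing is moved, degrees in the
          star are the original degrees, and \<open>H\<close> would be the excluded
          \<open>B31\<close>.\<close>
        then have root: "u \<in> e" if "e \<in> E" for e
          using that by blast
        have ch: "x \<in> children e \<longleftrightarrow> x \<in> e" if "x \<noteq> u" "e \<in> E" for x e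
          using root[OF that(2)] that parent_root[of e] by (simp add: E_def children_def)
        have ch': "card {e \<in> E. x \<in> e} = deg x" if "x \<noteq> u" for x
          unfolding deg_def using ch[OF that] by (metis (no_types, lifting))
        have card_v: "card {e \<in> E. v \<in> e} = 2"
          using ch'[of v] vw by simp
        have "card E = card {e \<in> E. v \<in> e} + card {e \<in> E. v \<notin> e}"
          by (subst card_Un_disjoint[symmetric]) (auto intro: arg_cong[where f = card])
        then have "card {e \<in> E. v \<notin> e} = m - 2"
          using card_v m(1) by simp
        moreover have "v \<in> e \<longleftrightarrow> w \<in> e" if "e \<in> E" for e
          using vw_iff[OF that] ch[OF _ that] vw by auto
        moreover have "card {e \<in> E. x \<in> e} = 1" if "x \<in> verts H - {u, v, w}" for x
          using ch'[of x] deg1[of x] that by auto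
        ultimately have "hgraph_iso H (B31 k (m - 2) 0 0)"
          using vw root card_v by (intro iso_B31[of v w]) auto
        with iso show ?thesis by simp
      qed
    qed
  qed (use finite_verts deg_pos in auto)
qed

end

section \<open>Comparing the spectral radii\<close>

theorem theorem4p6:
  fixes k m :: nat and H :: "'a hgraph"
  assumes "k \<ge> 3" and "m \<ge> 5" and "H \<in> bicyclic_kgraphs k m"
  shows "(rho k (B2 k (m - 4) 1) < rho k (B2 k (m - 3) 0) \<and>
          rho k (B2 k (m - 3) 0) = rho k (B31 k (m - 2) 0 0)) \<and>
         (\<not> hgraph_iso H (B2 k (m - 4) 1) \<and> \<not> hgraph_iso H (B2 k (m - 3) 0) \<and>
          \<not> hgraph_iso H (B31 k (m - 2) 0 0) \<longrightarrow>
          rho k H < rho k (B2 k (m - 4) 1))"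
proof -
  \<comment> \<open>The larger root of \<open>(t - m - 5) * (t - 1) = 9\<close>, which is the
    condition of \<open>rho_B2\<close> for \<open>a = m - 4\<close> and \<open>b = 1\<close> after
    clearing the denominator.\<close>
  define t where "t = ((real m + 6) + sqrt ((real m + 4)\<^sup>2 + 36)) / 2"
  define s where "s = sqrt ((real m + 4)\<^sup>2 + 36)"
  have s2: "s\<^sup>2 = (real m + 4)\<^sup>2 + 36"
    by (simp add: s_def)
  have t_s: "t = (real m + 6 + s) / 2"
    by (simp add: t_def s_def)
  have "s > real m + 4"
    unfolding s_def by (rule real_less_rsqrt) simp
  then have t5: "real m + 5 < t"
    by (simp add: t_s)
  \<comment> \<open>This amounts to \<open>m > 4\<close>. For \<open>m = 4\<close> it would be an
    equality, in accordance with the symmetry between \<open>B2 k 0 1\<close> and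
    \<open>B2 k 1 0\<close>.\<close>
  have "(real m + 4)\<^sup>2 + 36 < (real m + 6)\<^sup>2"
    using assms(2) by (simp add: power2_eq_square algebra_simps)
  then have "s < real m + 6"
    unfolding s_def by (intro real_less_lsqrt) auto
  then have t6: "t < real m + 6"
    by (simp add: t_s)
  have "4 * ((t - real m - 5) * (t - 1)) = s\<^sup>2 - (real m + 4)\<^sup>2"
    by (simp add: t_s power2_eq_square field_simps)
  then have t9: "(t - real m - 5) * (t - 1) = 9"
    using s2 by linarith
  have t10: "t > 10" using t5 assms(2) by linarith
  have "real (m - 4) + 9 * t / (t - real 1) = t"
    using t9 t10 assms(2) by (simp add: of_nat_diff field_simps)
  then have r1: "rho k (B2 k (m - 4) 1) = root k t"
    using t10 by (intro rho_B2[OF assms(1)]) auto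
  have r2: "rho k (B2 k (m - 3) 0) = root k (real m + 6)"
    using assms(2) by (intro rho_B2[OF assms(1)]) (auto simp: of_nat_diff field_simps)
  have r3: "rho k (B31 k (m - 2) 0 0) = root k (real m + 6)"
    using rho_B31[OF assms(1), of "m - 2"] assms(2) by (simp add: of_nat_diff add.commute)
  have "rho k H < root k t"
    if iso: "\<not> hgraph_iso H (B2 k (m - 4) 1)" "\<not> hgraph_iso H (B2 k (m - 3) 0)"
      "\<not> hgraph_iso H (B31 k (m - 2) 0 0)"
  proof (rule rho_less_root_rooted)
    show kg: "kgraph k H" and "k \<ge> 3" and "t > 0"
      using assms t10 by (auto simp: bicyclic_kgraphs_def)
    have con: "hconnected H" and sz: "size (edges H) = m" and bi: "card (verts H) + 1 = m * (k - 1)"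
      using assms(3) by (auto simp: bicyclic_kgraphs_def bicyclic_def)
    have mk: "multi_kgraph k H" using kg by (simp add: kgraph_def)
    fix y :: "'a \<Rightarrow> real" and u
    assume y: "\<And>v. y v \<ge> 0" and u: "u \<in> verts H" and max: "\<And>v. v \<in> verts H \<Longrightarrow> y v \<le> y u"
    have "k \<ge> 1" using assms(1) by simp
    then obtain p where p: "\<And>e. e \<in># edges H \<Longrightarrow> p e \<in> e" "\<And>e. e \<in># edges H \<Longrightarrow> u \<in> e \<Longrightarrow> p e = u"
        "\<And>v. v \<in> verts H - {u} \<Longrightarrow> \<exists>e\<in>set_mset (edges H). v \<in> e - {p e}"
      using hconnected_parents[OF mk _ con u] by metis
    \<comment> \<open>The root depends on the vector \<open>y\<close>, so parents can be chosen only
      after both are fixed.\<close>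
    interpret rooted_hypergraph k H u p
      using kg assms(1) u p by unfold_locales auto
    have "card E = m"
      using sz by (simp add: edges_eq)
    then show "\<exists>\<phi> \<beta>. rooted_labelling k H y u t \<phi> \<beta>"
      using assms(2) bi t5 t9 iso y max by (intro labelling_exists) auto
  qed
  moreover have "root k t < root k (real m + 6)"
    using t6 assms(1) by simp
  ultimately show ?thesis
    using r1 r2 r3 by simp
qed

end
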